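(* There is a universal constant $K>0$ such that the following holds. Let $n\ge1$ be an integer and $0<\delta<1$. Let $m=2^{\lfloor n/2\rfloor}$, let $C_1,\dots,C_n$ be Hermitian $m\times m$ complex matrices with $C_i^2=\mathrm{Id}$ for all $i$ and $C_iC_j+C_jC_i=0$ for all $i\ne j$, and let $P_{i,+}$ and $P_{i,-}$ be the orthogonal projections on the $+1$ and $-1$ eigenspaces of $C_i$, respectively. Then there exists an embedding with distortion $1+\delta$ into $\mathsf{S}_1^d$, for some $d\le n^{K/\delta^2}$, of the metric space induced by the $2n+2$ points $$0,\quad \tfrac1m\mathrm{Id},\quad \tfrac1mP_{i,+},\ \tfrac1mP_{i,-}\quad(i\in\{1,\dots,n\})$$ of $\mathsf{S}_1^m$.
   Context: For an integer $m\ge1$, $\mathsf{S}_1^m$ denotes the space of linear operators on $\mathbb{C}^m$ equipped with the Schatten-1 (nuclear) norm $\|A\|_{\mathsf{S}_1}$, the sum of the singular values of $A$. Points $A_1,\dots,A_N\in\mathsf{S}_1^m$ embed into $\mathsf{S}_1^d$ with distortion $1+\delta$ if there exist $A'_1,\dots,A'_N\in\mathsf{S}_1^d$ such that $\|A'_i-A'_j\|_{\mathsf{S}_1}\le\|A_i-A_j\|_{\mathsf{S}_1}\le(1+\delta)\|A'_i-A'_j\|_{\mathsf{S}_1}$ for all $i,j$. For even $n$ an explicit choice of the $C_i$ is $C_{2i-1}=X^{\otimes(i-1)}\otimes Z\otimes\mathrm{Id}^{\otimes(n/2-i)}$ and $C_{2i}=X^{\otimes(i-1)}\otimes Y\otimes\mathrm{Id}^{\otimes(n/2-i)}$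 for $i\in\{1,\dots,n/2\}$, with $X=\begin{pmatrix}0&1\\1&0\end{pmatrix}$, $Y=\begin{pmatrix}0&i\\-i&0\end{pmatrix}$ (here $i$ in the entries of $Y$ is the imaginary unit), $Z=\begin{pmatrix}1&0\\0&-1\end{pmatrix}$. *)

theory Defs
  imports
    Complex_Main
    "HOL-Computational_Algebra.Fundamental_Theorem_Algebra"
    "Jordan_Normal_Form.Schur_Decomposition"
begin

definition hermitian_mat :: "complex mat \<Rightarrow> bool" where
  "hermitian_mat A \<longleftrightarrow> mat_adjoint A = A"

(* The eigenvalues of the positive semidefinite matrix A^* A, with multiplicity; they are
   non-negative reals, so applying Re before taking the square root loses nothing. *)
definition singular_values :: "complex mat \<Rightarrow> real multiset" where
  "singular_values A =
     image_mset (\<lambda>x. sqrt (Re x)) (proots (char_poly (mat_adjoint A * A)))"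

definition schatten1_norm :: "complex mat \<Rightarrow> real" where
  "schatten1_norm A = sum_mset (singular_values A)"

(* Contains the zero vector, and equals {0} if k is not an eigenvalue. *)
definition eigenspace :: "complex mat \<Rightarrow> complex \<Rightarrow> complex vec set" where
  "eigenspace A k = {v \<in> carrier_vec (dim_row A). A *\<^sub>v v = k \<cdot>\<^sub>v v}"

definition is_orth_projection :: "nat \<Rightarrow> complex mat \<Rightarrow> complex vec set \<Rightarrow> bool" where
  "is_orth_projection m P W \<longleftrightarrow>
     P \<in> carrier_mat m m \<and>
     (\<forall>v \<in> carrier_vec m. P *\<^sub>v v \<in> W \<and> (\<forall>w \<in> W. (v - P *\<^sub>v v) \<bullet>c w = 0))"

definition embeds_S1 :: "complex mat list \<Rightarrow> nat \<Rightarrow> real \<Rightarrow> bool" where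
  "embeds_S1 As d D \<longleftrightarrow>
     (\<exists>Bs. length Bs = length As \<and> set Bs \<subseteq> carrier_mat d d \<and>
        (\<forall>i < length As. \<forall>j < length As.
           schatten1_norm (Bs ! i - Bs ! j) \<le> schatten1_norm (As ! i - As ! j) \<and>
           schatten1_norm (As ! i - As ! j) \<le> D * schatten1_norm (Bs ! i - Bs ! j)))"

end

(* If T_k are trace-free Hermitian unitaries with T_k T_l + T_l T_k = 2 g_kl Id, then (T_k - T_l)^2 is
   the scalar 2 - 2 g_kl, so all distances between the points 0, Id, (Id + T_k)/2, normalised by the
   dimension, depend only on the Gram matrix g and not on the dimension. The given projections are of
   this form with T = C_i and T = -C_i. By a union bound over sign vectors there are n unit vectors
   in R^k, k = O(log n / delta^2), with inner products at most delta/2 in absolute value; replacing C_i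
   by the corresponding linear combination of k anticommuting matrices of size 2^k perturbs the Gram
   matrix by at most delta/2. *)
theory Submission
  imports Defs "HOL-Library.FuncSet"
begin

section \<open>Hermitian matrices and the trace\<close>

text \<open>Every difference of two of the points is a real multiple of a Hermitian H with H^4
  proportional to H^2: a projection or a matrix with scalar square. Its nonzero singular values
  therefore coincide and a trace determines the norm, so no general theory of the Schatten norm
  enters, not even a triangle inequality. An embedding must not expand, so the image is shrunk by
  1/sqrt(1 + \<delta>/2). This also shrinks the distances that the perturbation had left exact; the
  factor 1 + \<delta> has to absorb both effects. For n = 1 the bound n^(K/\<delta>^2) equals 1 and
  leaves no room for a perturbation; there m = 1 and the points stay where they are. For n \<ge> 2
  each matrix has an anticommuting partner, and this is what makes it trace-free.\<close>

lemma smult_smult_mat: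
  fixes A :: "'a :: semigroup_mult mat"
  shows "a \<cdot>\<^sub>m (b \<cdot>\<^sub>m A) = (a * b) \<cdot>\<^sub>m A"
  by (rule eq_matI) (simp_all add: mult.assoc)

lemma dim_mat_adjoint [simp]:
  "dim_row (mat_adjoint A) = dim_col A" "dim_col (mat_adjoint A) = dim_row A"
  by (auto simp: mat_adjoint_def)

lemma index_mat_adjoint:
  fixes A :: "complex mat"
  assumes "i < dim_col A" "j < dim_row A"
  shows "mat_adjoint A $$ (i, j) = cnj (A $$ (j, i))"
  using assms by (simp add: mat_adjoint_def mat_of_rows_index)

lemma hermitian_mat_index:
  assumes "hermitian_mat A" "A \<in> carrier_mat n n" "i < n" "j < n"
  shows "cnj (A $$ (j, i)) = A $$ (i, j)"
  using assms index_mat_adjoint[of i A j] unfolding hermitian_mat_def by auto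

lemma hermitian_matI:
  assumes A: "A \<in> carrier_mat n n"
    and "\<And>i j. i < n \<Longrightarrow> j < n \<Longrightarrow> cnj (A $$ (j, i)) = A $$ (i, j)"
  shows "hermitian_mat A"
  unfolding hermitian_mat_def
  by (rule eq_matI) (use assms in \<open>simp_all add: index_mat_adjoint\<close>)

lemma hermitian_mat_one [simp]: "hermitian_mat (1\<^sub>m n)"
  by (rule hermitian_matI[of _ n]) auto

lemma hermitian_mat_add:
  assumes "A \<in> carrier_mat n n" "B \<in> carrier_mat n n" "hermitian_mat A" "hermitian_mat B"
  shows "hermitian_mat (A + B)"
  by (rule hermitian_matI[of _ n]) (use assms in \<open>simp_all add: hermitian_mat_index[of _ n]\<close>)

lemma hermitian_mat_smult:
  assumes "A \<in> carrier_mat n n" "hermitian_mat A"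
  shows "hermitian_mat (complex_of_real r \<cdot>\<^sub>m A)"
  by (rule hermitian_matI[of _ n]) (use assms in \<open>simp_all add: hermitian_mat_index[of _ n]\<close>)

lemma hermitian_mat_uminus:
  assumes "A \<in> carrier_mat n n" "hermitian_mat A"
  shows "hermitian_mat (- A)"
  by (rule hermitian_matI[of _ n]) (use assms in \<open>simp_all add: hermitian_mat_index[of _ n]\<close>)

lemma hermitian_mat_minus:
  assumes "A \<in> carrier_mat n n" "B \<in> carrier_mat n n" "hermitian_mat A" "hermitian_mat B"
  shows "hermitian_mat (A - B)"
  by (rule hermitian_matI[of _ n]) (use assms in \<open>simp_all add: minus_carrier_mat hermitian_mat_index[of _ n]\<close>)

definition mat_trace :: "complex mat \<Rightarrow> complex" where
  "mat_trace A = (\<Sum>i<dim_row A. A $$ (i, i))"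

lemma mat_trace_add:
  "A \<in> carrier_mat n n \<Longrightarrow> B \<in> carrier_mat n n \<Longrightarrow> mat_trace (A + B) = mat_trace A + mat_trace B"
  by (auto simp: mat_trace_def sum.distrib)

lemma mat_trace_smult: "A \<in> carrier_mat n n \<Longrightarrow> mat_trace (c \<cdot>\<^sub>m A) = c * mat_trace A"
  by (auto simp: mat_trace_def sum_distrib_left)

lemma mat_trace_uminus: "A \<in> carrier_mat n n \<Longrightarrow> mat_trace (- A) = - mat_trace A"
  by (auto simp: mat_trace_def sum_negf)

lemma mat_trace_one [simp]: "mat_trace (1\<^sub>m n) = of_nat n"
  by (simp add: mat_trace_def)

lemma mat_trace_mult_commute:
  assumes "A \<in> carrier_mat n m" "B \<in> carrier_mat m n"
  shows "mat_trace (A * B) = mat_trace (B * A)"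
proof -
  have "mat_trace (A * B) = (\<Sum>i<n. \<Sum>j<m. A $$ (i, j) * B $$ (j, i))"
    using assms by (auto simp: mat_trace_def scalar_prod_def lessThan_atLeast0)
  also have "\<dots> = (\<Sum>j<m. \<Sum>i<n. B $$ (j, i) * A $$ (i, j))"
    by (subst sum.swap) (simp add: mult.commute)
  also have "\<dots> = mat_trace (B * A)"
    using assms by (auto simp: mat_trace_def scalar_prod_def lessThan_atLeast0)
  finally show ?thesis .
qed

text \<open>For j different from i one of the entries (i, j) and (j, i) lies below the diagonal, so
  only j = i contributes. A quadratic relation for a triangular matrix thus passes to its
  eigenvalues.\<close>

lemma upper_triangular_square_diag:
  fixes B :: "complex mat"
  assumes B: "B \<in> carrier_mat n n" "upper_triangular B" and i: "i < n"
  shows "(B * B) $$ (i, i) = B $$ (i, i) * B $$ (i, i)"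
proof -
  have "(B * B) $$ (i, i) = (\<Sum>j\<in>{0..<n}. B $$ (i, j) * B $$ (j, i))"
    using B i by (simp add: scalar_prod_def)
  also have "\<dots> = (\<Sum>j\<in>{i}. B $$ (i, j) * B $$ (j, i))"
  proof (rule sum.mono_neutral_right)
    show "\<forall>j\<in>{0..<n} - {i}. B $$ (i, j) * B $$ (j, i) = 0"
    proof
      fix j assume j: "j \<in> {0..<n} - {i}"
      show "B $$ (i, j) * B $$ (j, i) = 0"
      proof (cases "j < i")
        case True
        then show ?thesis using B i by (auto simp: upper_triangular_def)
      next
        case False
        then have "i < j" using j by auto
        then show ?thesis using B j by (auto simp: upper_triangular_def)
      qed
    qed
  qed (use i in auto)
  finally show ?thesis by simp
qed

section \<open>Schatten 1-norms of matrices with few singular values\<close>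

text \<open>If \<open>M = A\<^sup>*A\<close> satisfies \<open>M\<^sup>2 = cM\<close>, every eigenvalue of \<open>M\<close> is \<open>0\<close> or \<open>c\<close>, so
  the sum of the square roots of the eigenvalues is a multiple of the trace.\<close>
lemma schatten1_norm_eq_trace:
  assumes A: "A \<in> carrier_mat n n" and c: "c \<ge> 0"
    and M: "mat_adjoint A * A = M" "M * M = complex_of_real c \<cdot>\<^sub>m M"
  shows "sqrt c * schatten1_norm A = Re (mat_trace M)"
proof -
  have Mc: "M \<in> carrier_mat n n" using A M(1) by (metis carrier_matD(1,2) carrier_matI dim_mat_adjoint(1) index_mult_mat(2,3))
  obtain es where es: "char_poly M = (\<Prod>a\<leftarrow>es. [:- a, 1:])"
    using char_poly_factorized[OF Mc] by blast
  obtain B P Q where BPQ: "schur_decomposition M es = (B, P, Q)"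
    by (cases "schur_decomposition M es")
  note schur = schur_decomposition[OF Mc es BPQ]
  then have sim: "similar_mat_wit M B P Q" and ut: "upper_triangular B" and diag: "diag_mat B = es"
    by auto
  note w = similar_mat_witD2[OF Mc sim]
  note w' = similar_mat_witD2[OF w(5) similar_mat_wit_sym[OF sim]]
  have "mat_trace M = mat_trace (P * (B * Q))"
    using w assoc_mult_mat[OF w(6) w(5) w(7)] by simp
  also have "\<dots> = mat_trace ((B * Q) * P)"
    using w by (intro mat_trace_mult_commute[of _ n n]) auto
  also have "(B * Q) * P = B"
    using w by (simp add: assoc_mult_mat[OF w(5) w(7) w(6)])
  finally have "mat_trace M = sum_list (diag_mat B)"
    by (simp add: mat_trace_def diag_mat_def interv_sum_list_conv_sum_set_nat lessThan_atLeast0)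
  then have tr: "mat_trace M = sum_list es" using diag by simp
  \<comment> \<open>Similarity carries M^2 = cM over to the Schur form \<open>B\<close>, whose
    diagonal lists the eigenvalues \<open>es\<close>.\<close>
  have BB: "B * B = complex_of_real c \<cdot>\<^sub>m B"
  proof -
    have "B * B = (Q * M * P) * (Q * M * P)" using w'(3) by simp
    also have "\<dots> = Q * M * (P * (Q * (M * P)))"
      using w(4,6,7) by (simp add: assoc_mult_mat[of _ n n _ n _ n])
    also have "P * (Q * (M * P)) = (P * Q) * (M * P)"
      using w(4,6,7) by (subst assoc_mult_mat[of _ n n _ n _ n]) auto
    also have "\<dots> = M * P" using w(1,4,6) by simp
    also have "Q * M * (M * P) = Q * (M * M) * P"
      using w(4,6,7) by (simp add: assoc_mult_mat[of _ n n _ n _ n])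
    also have "\<dots> = complex_of_real c \<cdot>\<^sub>m (Q * M * P)"
      using w(4,6,7) by (simp add: M(2) mult_smult_distrib[of _ n n _ n] mult_smult_assoc_mat[of _ n n _ n])
    also have "Q * M * P = B" using w'(3) by simp
    finally show ?thesis .
  qed
  have e: "sqrt c * sqrt (Re x) = Re x" if x: "x \<in> set es" for x
  proof -
    obtain i where i: "i < n" "x = B $$ (i, i)"
      using x w(5) unfolding diag[symmetric] diag_mat_def by auto
    have "x * x = (B * B) $$ (i, i)"
      using upper_triangular_square_diag[OF w(5) ut i(1)] i(2) by simp
    also have "\<dots> = complex_of_real c * x"
      using i w(5) unfolding BB by simp
    finally have "x = 0 \<or> x = complex_of_real c" by simp
    then show ?thesis using c by auto
  qed
  have pr: "proots (char_poly M) = mset es"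
  proof -
    have "proots (\<Prod>a\<leftarrow>xs. [:- a, 1:]) = mset xs" for xs :: "complex list"
    proof (induction xs)
      case (Cons a xs)
      have "(\<Prod>a\<leftarrow>xs. [:- a, 1:]) \<noteq> (0 :: complex poly)" by (auto simp: prod_list_zero_iff)
      then show ?case using Cons by (simp add: proots_mult del: mult_pCons_left)
    qed simp
    then show ?thesis using es by simp
  qed
  have "schatten1_norm A = (\<Sum>x\<leftarrow>es. sqrt (Re x))"
    unfolding schatten1_norm_def singular_values_def M(1) pr
    by (simp flip: mset_map sum_mset_sum_list)
  then have "sqrt c * schatten1_norm A = (\<Sum>x\<leftarrow>es. sqrt c * sqrt (Re x))"
    by (simp add: sum_list_const_mult)
  also have "\<dots> = (\<Sum>x\<leftarrow>es. Re x)"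
    using e by (metis (no_types, lifting) map_eq_conv)
  also have "\<dots> = Re (sum_list es)"
    by (induction es) auto
  finally show ?thesis by (simp add: tr)
qed

lemma schatten1_norm_zero [simp]: "schatten1_norm (0\<^sub>m n n) = 0"
proof -
  have "mat_adjoint (0\<^sub>m n n) * 0\<^sub>m n n = (0\<^sub>m n n :: complex mat)"
    by (intro right_mult_zero_mat carrier_matI) auto
  \<comment> \<open>For M = 0 any c is admissible; a positive one is taken, since c = 0 would make
    the norm vanish from the equation.\<close>
  then show ?thesis
    using schatten1_norm_eq_trace[of "0\<^sub>m n n" n 1 "0\<^sub>m n n"]
    by (simp add: mat_trace_def)
qed

text \<open>A Hermitian \<open>H\<close> with H^4 = c H^2 has its eigenvalues among 0, sqrt c and
  -sqrt c, so its norm is sqrt c times its rank, that is tr(H^2) / sqrt c. The factor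
  \<open>r\<close> is carried along so that normalised matrices need no separate homogeneity
  law.\<close>

lemma schatten1_norm_smult:
  assumes H: "H \<in> carrier_mat n n" "hermitian_mat H" and r: "r \<ge> 0" and c: "c > 0"
    and HH: "(H * H) * (H * H) = complex_of_real c \<cdot>\<^sub>m (H * H)"
  shows "schatten1_norm (complex_of_real r \<cdot>\<^sub>m H) = r * (Re (mat_trace (H * H)) / sqrt c)"
proof (cases "r = 0")
  case True
  have "0 \<cdot>\<^sub>m H = 0\<^sub>m n n" using H by auto
  then show ?thesis using True by simp
next
  case False
  let ?A = "complex_of_real r \<cdot>\<^sub>m H" and ?M = "complex_of_real (r\<^sup>2) \<cdot>\<^sub>m (H * H)"
  have adj: "mat_adjoint ?A = ?A"
    using hermitian_mat_smult[OF H, of r] by (simp add: hermitian_mat_def)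
  have "?A * ?A = ?M"
    using H by (simp add: mult_smult_distrib[of _ n n _ n] mult_smult_assoc_mat[of _ n n _ n]
        smult_smult_mat power2_eq_square)
  then have M1: "mat_adjoint ?A * ?A = ?M"
    by (simp add: adj)
  have M2: "?M * ?M = complex_of_real (r\<^sup>2 * c) \<cdot>\<^sub>m ?M"
    using H HH by (simp add: mult_smult_distrib[of _ n n _ n] mult_smult_assoc_mat[of _ n n _ n]
        smult_smult_mat power2_eq_square mult_ac)
  have "sqrt (r\<^sup>2 * c) * schatten1_norm ?A = Re (mat_trace ?M)"
    by (rule schatten1_norm_eq_trace[OF _ _ M1 M2]) (use H c in auto)
  moreover have "mat_trace ?M = r\<^sup>2 * mat_trace (H * H)"
    using H by (subst mat_trace_smult[of _ n]) auto
  ultimately have "r * (sqrt c * schatten1_norm ?A) = r * (r * Re (mat_trace (H * H)))"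
    using r by (simp add: real_sqrt_mult power2_eq_square mult_ac)
  then show ?thesis using False c by (simp add: field_simps)
qed

lemma schatten1_norm_projection:
  assumes H: "P \<in> carrier_mat n n" "hermitian_mat P" "P * P = P" and r: "r \<ge> 0"
  shows "schatten1_norm (complex_of_real r \<cdot>\<^sub>m P) = r * Re (mat_trace P)"
proof -
  have "1 \<cdot>\<^sub>m P = P" by (rule eq_matI) auto
  then show ?thesis using schatten1_norm_smult[of P n r 1] assms by simp
qed

lemma schatten1_norm_scalar_square:
  assumes U: "U \<in> carrier_mat n n" "hermitian_mat U" and q: "q \<ge> 0" and r: "r \<ge> 0"
    and UU: "U * U = complex_of_real q \<cdot>\<^sub>m 1\<^sub>m n"
  shows "schatten1_norm (complex_of_real r \<cdot>\<^sub>m U) = r * (sqrt q * n)"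
proof -
  have UU2: "(U * U) * (U * U) = complex_of_real q \<cdot>\<^sub>m (U * U)"
    unfolding UU by (simp add: mult_smult_distrib[of _ n n _ n] mult_smult_assoc_mat[of _ n n _ n])
  have tr: "mat_trace (U * U) = complex_of_real (q * n)"
    unfolding UU by (subst mat_trace_smult[of _ n]) auto
  show ?thesis
  proof (cases "q = 0")
    case True
    have "U * U = 0\<^sub>m n n" unfolding UU True by auto
    \<comment> \<open>\<open>schatten1_norm_smult\<close> asks for a positive constant; as U^2 = 0,
      the constant 1 serves. This case occurs for two equal reflections, where the Gram entry is
      1.\<close>
    then have "(U * U) * (U * U) = complex_of_real 1 \<cdot>\<^sub>m (U * U)" by simp
    from schatten1_norm_smult[OF U r _ this] show ?thesis using True tr by simp
  next
    case False
    with q have q': "q > 0" by simp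
    have "q * n / sqrt q = sqrt q * n" using q' by (simp add: field_simps)
    then show ?thesis using schatten1_norm_smult[OF U r q' UU2] tr by simp
  qed
qed

text \<open>For the entry a, the matrix M is the scalar |a|^2, and the trace formula says that |a|
  times the norm is |a|^2. This serves the case n = 1, where the map is the identity and a distance
  t must satisfy t \<le> (1 + \<delta>) t.\<close>

lemma schatten1_norm_dim_one_nonneg:
  assumes A: "A \<in> carrier_mat 1 1"
  shows "schatten1_norm A \<ge> 0"
proof -
  let ?c = "(cmod (A $$ (0, 0)))\<^sup>2"
  have M: "mat_adjoint A * A = complex_of_real ?c \<cdot>\<^sub>m 1\<^sub>m 1"
    using A by (auto simp: scalar_prod_def index_mat_adjoint mult.commute simp flip: complex_norm_square)
  have *: "sqrt ?c * schatten1_norm A = ?c"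
  proof -
    have "(complex_of_real ?c \<cdot>\<^sub>m 1\<^sub>m 1) * (complex_of_real ?c \<cdot>\<^sub>m 1\<^sub>m 1)
        = complex_of_real ?c \<cdot>\<^sub>m (complex_of_real ?c \<cdot>\<^sub>m 1\<^sub>m 1)"
      by (rule eq_matI) (auto simp: scalar_prod_def)
    from schatten1_norm_eq_trace[OF A _ M this] show ?thesis
      by (simp add: mat_trace_smult[of _ 1])
  qed
  show ?thesis
  proof (cases "A $$ (0, 0) = 0")
    case True
    then have "A = 0\<^sub>m 1 1" using A by auto
    then show ?thesis by simp
  next
    case False
    with * show ?thesis
      by (simp add: power2_eq_square)
  qed
qed

lemma schatten1_norm_uminus:
  assumes A: "A \<in> carrier_mat n n"
  shows "schatten1_norm (- A) = schatten1_norm A"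
proof -
  have "mat_adjoint (- A) * (- A) = mat_adjoint A * A"
    by (rule eq_matI) (use A in \<open>auto simp: scalar_prod_def index_mat_adjoint sum_negf\<close>)
  then show ?thesis by (simp add: schatten1_norm_def singular_values_def)
qed

lemma schatten1_norm_minus_commute:
  assumes "A \<in> carrier_mat n n" "B \<in> carrier_mat n n"
  shows "schatten1_norm (A - B) = schatten1_norm (B - A)"
proof -
  have "A - B = - (B - A)"
    by (rule eq_matI) (use assms in auto)
  then show ?thesis using schatten1_norm_uminus[of "B - A" n] assms by (simp add: minus_carrier_mat)
qed

section \<open>Nearly orthogonal sign vectors\<close>

lemma tanh_le_self:
  fixes t :: real
  assumes "t \<ge> 0"
  shows "tanh t \<le> t"
proof -
  have "0 - tanh 0 \<le> t - tanh t"
  proof (rule DERIV_nonneg_imp_nondecreasing[OF assms])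
    fix x :: real
    have "((\<lambda>x. x - tanh x) has_real_derivative (tanh x)\<^sup>2) (at x)"
      by (auto intro!: derivative_eq_intros)
    then show "\<exists>y. ((\<lambda>x. x - tanh x) has_real_derivative y) (at x) \<and> 0 \<le> y"
      by (intro exI[of _ "(tanh x)\<^sup>2"]) simp
  qed
  then show ?thesis by simp
qed

text \<open>Hoeffding's bound for the moment generating function of a random sign: t^2/2 - ln (cosh
  t) vanishes at 0, and its derivative t - tanh t is nonnegative by
  \<open>tanh_le_self\<close>.\<close>

lemma cosh_le_exp_half_square:
  fixes t :: real
  assumes "t \<ge> 0"
  shows "cosh t \<le> exp (t\<^sup>2 / 2)"
proof -
  have "0\<^sup>2 / 2 - ln (cosh 0) \<le> t\<^sup>2 / 2 - ln (cosh t)"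
  proof (rule DERIV_nonneg_imp_nondecreasing[OF assms])
    fix x :: real assume x: "0 \<le> x"
    have "((\<lambda>x. x\<^sup>2 / 2 - ln (cosh x)) has_real_derivative (x - tanh x)) (at x)"
      by (auto intro!: derivative_eq_intros simp: tanh_def)
    then show "\<exists>y. ((\<lambda>x. x\<^sup>2 / 2 - ln (cosh x)) has_real_derivative y) (at x) \<and> 0 \<le> y"
      using tanh_le_self[OF x] by (intro exI[of _ "x - tanh x"]) simp
  qed
  then have "ln (cosh t) \<le> t\<^sup>2 / 2" by simp
  then show ?thesis by (metis cosh_real_pos exp_le_cancel_iff exp_ln)
qed

text \<open>\<open>PiE\<close> fixes the values outside \<open>{..<k}\<close>, which makes the set
  finite with 2^k elements, so that counting can replace probability.\<close>

definition sign_vectors :: "nat \<Rightarrow> (nat \<Rightarrow> real) set" where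
  "sign_vectors k = PiE {..<k} (\<lambda>_. {-1, 1})"

lemma finite_sign_vectors [simp]: "finite (sign_vectors k)"
  by (simp add: sign_vectors_def finite_PiE)

lemma card_sign_vectors: "card (sign_vectors k) = 2 ^ k"
  by (simp add: sign_vectors_def card_PiE flip: numeral_2_eq_2)

lemma sign_vectors_cases: "x \<in> sign_vectors k \<Longrightarrow> l < k \<Longrightarrow> x l = -1 \<or> x l = 1"
  by (auto simp: sign_vectors_def PiE_iff)

text \<open>Chernoff bound, written as a count: Markov's inequality for \<open>exp (t \<langle>u, y\<rangle>)\<close>.\<close>
lemma card_large_inner_le:
  assumes u: "\<And>l. l < k \<Longrightarrow> u l = -1 \<or> u l = 1" and t: "t \<ge> 0"
  shows "real (card {y \<in> sign_vectors k. (\<Sum>l<k. u l * y l) \<ge> t * k}) \<le> 2 ^ k * exp (- (k * t\<^sup>2 / 2))"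
    (is "real (card ?B) \<le> _")
proof -
  \<comment> \<open>The threshold \<open>t\<close> itself is the parameter of the exponential
    weight; it minimises exp(k(a^2/2 - a t)) over a.\<close>
  have "real (card ?B) * exp (t\<^sup>2 * k) = (\<Sum>y\<in>?B. exp (t\<^sup>2 * k))"
    by simp
  also have "\<dots> \<le> (\<Sum>y\<in>?B. exp (t * (\<Sum>l<k. u l * y l)))"
  proof (rule sum_mono)
    fix y assume "y \<in> ?B"
    then have "t * (t * k) \<le> t * (\<Sum>l<k. u l * y l)"
      using t by (intro mult_left_mono) auto
    then show "exp (t\<^sup>2 * k) \<le> exp (t * (\<Sum>l<k. u l * y l))"
      by (simp add: power2_eq_square mult.assoc)
  qed
  also have "\<dots> \<le> (\<Sum>y\<in>sign_vectors k. exp (t * (\<Sum>l<k. u l * y l)))"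
    by (rule sum_mono2) auto
  also have "\<dots> = (\<Sum>y\<in>sign_vectors k. \<Prod>l<k. exp (t * (u l * y l)))"
    by (simp add: sum_distrib_left exp_sum)
  \<comment> \<open>Interchanging sum and product expresses the independence of the
    coordinates.\<close>
  also have "\<dots> = (\<Prod>l<k. \<Sum>v\<in>{-1, 1}. exp (t * (u l * v)))"
    unfolding sign_vectors_def by (rule prod_sum_PiE[symmetric]) auto
  also have "\<dots> = (\<Prod>l<k. 2 * cosh t)"
  proof (rule prod.cong[OF refl])
    fix l assume "l \<in> {..<k}"
    then show "(\<Sum>v\<in>{-1, 1}. exp (t * (u l * v))) = 2 * cosh t"
      using u[of l] by (auto simp: cosh_field_def)
  qed
  also have "\<dots> = 2 ^ k * cosh t ^ k"
    by (simp add: power_mult_distrib)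
  also have "\<dots> \<le> 2 ^ k * exp (t\<^sup>2 / 2) ^ k"
    using cosh_le_exp_half_square[OF t] by (intro mult_left_mono power_mono) auto
  also have "\<dots> = 2 ^ k * exp (- (k * t\<^sup>2 / 2)) * exp (t\<^sup>2 * k)"
    by (simp add: mult.commute flip: exp_of_nat_mult exp_add)
  finally show ?thesis by simp
qed

text \<open>The vectors are chosen greedily: each earlier one rules out two Chernoff sets, together
  fewer than 2^k sign vectors. The hypothesis is inherited by smaller \<open>n\<close>, so it yields
  both the earlier vectors and the count.\<close>

lemma exists_nearly_orthogonal_signs:
  assumes "t \<ge> 0" "2 * real n * exp (- (k * t\<^sup>2 / 2)) < 1"
  shows "\<exists>x. (\<forall>i<n. x i \<in> sign_vectors k) \<and>
             (\<forall>i<n. \<forall>j<i. \<bar>\<Sum>l<k. x j l * x i l\<bar> \<le> t * k)"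
  using assms(2)
proof (induction n)
  case (Suc n)
  let ?e = "exp (- (k * t\<^sup>2 / 2))"
  have "2 * real n * ?e \<le> 2 * real (Suc n) * ?e"
    by (intro mult_right_mono) auto
  with Suc.prems have less: "2 * real n * ?e < 1" by linarith
  then have "\<exists>x. (\<forall>i<n. x i \<in> sign_vectors k) \<and>
             (\<forall>i<n. \<forall>j<i. \<bar>\<Sum>l<k. x j l * x i l\<bar> \<le> t * k)"
    by (rule Suc.IH)
  then obtain x where x: "\<And>i. i < n \<Longrightarrow> x i \<in> sign_vectors k"
      "\<And>i j. i < n \<Longrightarrow> j < i \<Longrightarrow> \<bar>\<Sum>l<k. x j l * x i l\<bar> \<le> t * k"
    by blast
  define B where "B u = {y \<in> sign_vectors k. (\<Sum>l<k. u l * y l) \<ge> t * k}" for u :: "nat \<Rightarrow> real"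
  \<comment> \<open>The negated vectors catch large negative inner products. They need not be
    extensional, hence need not lie in \<open>sign_vectors k\<close>;
    \<open>card_large_inner_le\<close> therefore constrains \<open>u\<close> only below
    \<open>k\<close>.\<close>
  let ?bad = "\<Union>i<n. B (x i) \<union> B (\<lambda>l. - x i l)"
  have "real (card ?bad) \<le> real (\<Sum>i<n. card (B (x i)) + card (B (\<lambda>l. - x i l)))"
    unfolding of_nat_le_iff
    by (rule order_trans[OF card_UN_le sum_mono[OF card_Un_le]]) simp
  also have "\<dots> \<le> (\<Sum>i<n. 2 * (2 ^ k * ?e))"
    unfolding of_nat_sum
  proof (rule sum_mono)
    fix i assume "i \<in> {..<n}"
    then have i: "i < n" by simp
    have "real (card (B (x i))) \<le> 2 ^ k * ?e"
      unfolding B_def using sign_vectors_cases[OF x(1)[OF i]] assms(1)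
      by (rule card_large_inner_le)
    moreover have "real (card (B (\<lambda>l. - x i l))) \<le> 2 ^ k * ?e"
      unfolding B_def using sign_vectors_cases[OF x(1)[OF i]] assms(1)
      by (intro card_large_inner_le) auto
    ultimately show "real (card (B (x i)) + card (B (\<lambda>l. - x i l))) \<le> 2 * (2 ^ k * ?e)"
      by simp
  qed
  also have "\<dots> = 2 ^ k * (2 * real n * ?e)" by simp
  also have "\<dots> < 2 ^ k * 1"
    using less by (intro mult_strict_left_mono) auto
  finally have lt: "real (card ?bad) < 2 ^ k * 1" .
  have "real (card ?bad) < real (card (sign_vectors k))"
    unfolding card_sign_vectors of_nat_power of_nat_numeral using lt by linarith
  then have "card ?bad < card (sign_vectors k)"
    unfolding of_nat_less_iff .
  moreover have "finite ?bad" by (simp add: B_def)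
  ultimately have "\<not> sign_vectors k \<subseteq> ?bad"
    using card_mono[of ?bad "sign_vectors k"] by (meson leD)
  then obtain y where y: "y \<in> sign_vectors k" "y \<notin> ?bad" by blast
  have le: "\<bar>\<Sum>l<k. x j l * y l\<bar> \<le> t * k" if "j < n" for j
  proof -
    have "\<not> (\<Sum>l<k. x j l * y l) \<ge> t * k" "\<not> (\<Sum>l<k. - x j l * y l) \<ge> t * k"
      using y that unfolding B_def by auto
    then show ?thesis by (simp add: sum_negf)
  qed
  show ?case
  proof (rule exI[of _ "x(n := y)"], intro conjI allI impI)
    fix i assume "i < Suc n"
    then show "(x(n := y)) i \<in> sign_vectors k"
      using x(1) y(1) by (cases "i = n") auto
  next
    fix i j assume "i < Suc n" "j < i"
    then show "\<bar>\<Sum>l<k. (x(n := y)) j l * (x(n := y)) i l\<bar> \<le> t * k"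
      using x(2) le by (cases "i = n") auto
  qed
qed simp

lemma exists_nearly_orthogonal_unit_vectors:
  assumes t: "t \<ge> 0" "2 * real n * exp (- (k * t\<^sup>2 / 2)) < 1" and k: "k > 0"
  shows "\<exists>x :: nat \<Rightarrow> nat \<Rightarrow> real. (\<forall>i<n. (\<Sum>l<k. x i l * x i l) = 1) \<and>
             (\<forall>i<n. \<forall>j<n. i \<noteq> j \<longrightarrow> \<bar>\<Sum>l<k. x i l * x j l\<bar> \<le> t)"
proof -
  obtain x where x: "\<And>i. i < n \<Longrightarrow> x i \<in> sign_vectors k"
      "\<And>i j. i < n \<Longrightarrow> j < i \<Longrightarrow> \<bar>\<Sum>l<k. x j l * x i l\<bar> \<le> t * k"
    using exists_nearly_orthogonal_signs[OF t] by blast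
  define z where "z i l = x i l / sqrt k" for i l
  have z: "(\<Sum>l<k. z i l * z j l) = (\<Sum>l<k. x i l * x j l) / k" for i j
    by (simp add: z_def sum_divide_distrib)
  have "(\<Sum>l<k. z i l * z i l) = 1" if "i < n" for i
  proof -
    have "(\<Sum>l<k. x i l * x i l) = (\<Sum>l<k. 1)"
      using sign_vectors_cases[OF x(1)[OF that]] by (intro sum.cong) fastforce+
    then show ?thesis using k by (simp add: z)
  qed
  moreover have "\<bar>\<Sum>l<k. z i l * z j l\<bar> \<le> t" if ij: "i < n" "j < n" "i \<noteq> j" for i j
  proof -
    have "\<bar>\<Sum>l<k. x i l * x j l\<bar> \<le> t * k"
      using x(2)[of i j] x(2)[of j i] ij by (cases "i < j") (auto simp: mult.commute)
    then show ?thesis using k by (simp add: z field_simps)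
  qed
  ultimately show ?thesis by blast
qed

section \<open>Projections onto the eigenspaces of a reflection\<close>

lemma inner_mult_hermitian:
  assumes H: "H \<in> carrier_mat n n" "hermitian_mat H"
    and u: "u \<in> carrier_vec n" and v: "v \<in> carrier_vec n"
  shows "v \<bullet>c (H *\<^sub>v u) = (H *\<^sub>v v) \<bullet>c u"
proof -
  have "v \<bullet>c (H *\<^sub>v u) = (\<Sum>i<n. \<Sum>j<n. v $ i * (cnj (H $$ (i, j)) * cnj (u $ j)))"
    using assms by (simp add: scalar_prod_def lessThan_atLeast0 sum_distrib_left)
  also have "\<dots> = (\<Sum>j<n. \<Sum>i<n. v $ i * (cnj (H $$ (i, j)) * cnj (u $ j)))"
    by (rule sum.swap)
  also have "\<dots> = (\<Sum>j<n. \<Sum>i<n. H $$ (j, i) * v $ i * cnj (u $ j))"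
    by (intro sum.cong refl) (use hermitian_mat_index[OF H(2,1)] in \<open>auto simp: mult_ac\<close>)
  also have "\<dots> = (H *\<^sub>v v) \<bullet>c u"
    using assms by (simp add: scalar_prod_def lessThan_atLeast0 sum_distrib_right)
  finally show ?thesis .
qed

lemma mat_eq_zeroI:
  fixes A :: "complex mat"
  assumes A: "A \<in> carrier_mat n n" and z: "\<And>v. v \<in> carrier_vec n \<Longrightarrow> A *\<^sub>v v = 0\<^sub>v n"
  shows "A = 0\<^sub>m n n"
proof (rule eq_matI)
  fix i j assume "i < dim_row (0\<^sub>m n n :: complex mat)" "j < dim_col (0\<^sub>m n n :: complex mat)"
  then have ij: "i < n" "j < n" by auto
  have "A $$ (i, j) = (A *\<^sub>v unit_vec n j) $ i"
    using A ij by simp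
  then show "A $$ (i, j) = 0\<^sub>m n n $$ (i, j)"
    using z[of "unit_vec n j"] ij by simp
qed (use A in auto)

text \<open>Put E = Id + C. Since CE = E, the range of E lies in the eigenspace, so every residual v
  - Pv is orthogonal to it; E being self-adjoint, this gives E(Id - P) = 0. As CP = P, the left side
  is E - 2P.\<close>

lemma orth_projection_eigenspace_one:
  assumes C: "C \<in> carrier_mat n n" "hermitian_mat C" "C * C = 1\<^sub>m n"
    and P: "is_orth_projection n P (eigenspace C 1)"
  shows "P = (1/2) \<cdot>\<^sub>m (1\<^sub>m n + C)"
proof -
  have Pc: "P \<in> carrier_mat n n"
    and PW: "\<And>v. v \<in> carrier_vec n \<Longrightarrow> P *\<^sub>v v \<in> eigenspace C 1"
    and Porth: "\<And>v w. v \<in> carrier_vec n \<Longrightarrow> w \<in> eigenspace C 1 \<Longrightarrow> (v - P *\<^sub>v v) \<bullet>c w = 0"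
    using P unfolding is_orth_projection_def by auto
  let ?E = "1\<^sub>m n + C"
  have E: "?E \<in> carrier_mat n n" "hermitian_mat ?E"
    using C by (auto intro: hermitian_mat_add[of _ n])
  have CE: "C * ?E = ?E"
    using C by (simp add: mult_add_distrib_mat[of _ n n _ n] comm_add_mat[of _ n n])
  have "C * P - P = 0\<^sub>m n n"
  proof (rule mat_eq_zeroI)
    fix v :: "complex vec" assume v: "v \<in> carrier_vec n"
    have "C *\<^sub>v (P *\<^sub>v v) = P *\<^sub>v v"
      using PW[OF v] by (simp add: eigenspace_def)
    moreover have "P *\<^sub>v v \<in> carrier_vec n" using Pc v by simp
    ultimately show "(C * P - P) *\<^sub>v v = 0\<^sub>v n"
      using C Pc v by (simp add: minus_mult_distrib_mat_vec[of _ n n] assoc_mult_mat_vec[of _ n n _ n])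
  qed (use C Pc in \<open>auto simp: minus_carrier_mat\<close>)
  then have CP: "C * P = P"
    using C Pc by (auto simp: mat_eq_iff)
  have "?E * (1\<^sub>m n - P) = 0\<^sub>m n n"
  proof (rule mat_eq_zeroI)
    fix v :: "complex vec" assume v: "v \<in> carrier_vec n"
    let ?r = "v - P *\<^sub>v v"
    have r: "?r \<in> carrier_vec n" using v Pc by (simp add: minus_carrier_vec)
    have "(?E *\<^sub>v ?r) \<bullet>c u = 0" if u: "u \<in> carrier_vec n" for u
    proof -
      have "C *\<^sub>v (?E *\<^sub>v u) = ?E *\<^sub>v u"
        using C(1) E(1) u CE by (simp flip: assoc_mult_mat_vec[of _ n n _ n])
      then have "?E *\<^sub>v u \<in> eigenspace C 1"
        using C(1) mult_mat_vec_carrier[OF E(1) u] by (simp add: eigenspace_def)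
      then show ?thesis
        using Porth[OF v] inner_mult_hermitian[OF E u r] by simp
    qed
    then have "(?E *\<^sub>v ?r) \<bullet>c (?E *\<^sub>v ?r) = 0"
      using E r by simp
    then have "?E *\<^sub>v ?r = 0\<^sub>v n"
      using E r conjugate_square_eq_0_vec[of "?E *\<^sub>v ?r" n] by simp
    then show "(?E * (1\<^sub>m n - P)) *\<^sub>v v = 0\<^sub>v n"
      using E Pc v by (simp add: assoc_mult_mat_vec[of _ n n _ n] minus_mult_distrib_mat_vec[of _ n n] minus_carrier_mat)
  qed (use E Pc in \<open>auto simp: minus_carrier_mat\<close>)
  moreover have "?E * (1\<^sub>m n - P) = ?E - (P + C * P)"
    using C Pc by (simp add: mult_minus_distrib_mat[of _ n n _ n] add_mult_distrib_mat[of _ n n _ _ n] minus_carrier_mat)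
  ultimately have "?E - (P + P) = 0\<^sub>m n n" using CP by simp
  then have *: "(?E - (P + P)) $$ (i, j) = 0" if "i < n" "j < n" for i j
    using that by simp
  show ?thesis
  proof (rule eq_matI)
    fix i j assume "i < dim_row ((1/2) \<cdot>\<^sub>m ?E)" "j < dim_col ((1/2) \<cdot>\<^sub>m ?E)"
    then have ij: "i < n" "j < n" using C by auto
    then show "P $$ (i, j) = ((1/2) \<cdot>\<^sub>m ?E) $$ (i, j)"
      using *[OF ij] C Pc by (simp add: field_simps)
  qed (use C Pc in auto)
qed

text \<open>The eigenspace of \<open>C\<close> for -1 is that of \<open>- C\<close> for 1. The form
  \<open>1\<^sub>m n + - C\<close> exhibits the projection as the point attached to the reflection
  \<open>- C\<close>.\<close>

lemma orth_projection_eigenspace_minus_one: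
  assumes C: "C \<in> carrier_mat n n" "hermitian_mat C" "C * C = 1\<^sub>m n"
    and P: "is_orth_projection n P (eigenspace C (- 1))"
  shows "P = (1/2) \<cdot>\<^sub>m (1\<^sub>m n + - C)"
proof (rule orth_projection_eigenspace_one)
  have *: "C *\<^sub>v v = - 1 \<cdot>\<^sub>v v \<longleftrightarrow> - C *\<^sub>v v = 1 \<cdot>\<^sub>v v" if v: "v \<in> carrier_vec n" for v
  proof -
    have "- C *\<^sub>v v = - 1 \<cdot>\<^sub>v (C *\<^sub>v v)"
      by (rule eq_vecI) (use C(1) v in \<open>auto simp: scalar_prod_def sum_negf\<close>)
    moreover have "C *\<^sub>v v = - 1 \<cdot>\<^sub>v (- 1 \<cdot>\<^sub>v (C *\<^sub>v v))"
      by (simp add: smult_smult_assoc)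
    ultimately show ?thesis
      by (metis mult_minus1 minus_minus smult_smult_assoc)
  qed
  have "eigenspace C (- 1) = eigenspace (- C) 1"
    using C(1) * unfolding eigenspace_def by auto
  with P show "is_orth_projection n P (eigenspace (- C) 1)" by simp
qed (use C in \<open>auto intro: hermitian_mat_uminus simp: uminus_mult_left_mat uminus_mult_right_mat\<close>)

text \<open>Conjugation by the involution \<open>D\<close> sends \<open>C\<close> to
  \<open>- C\<close> but preserves the trace.\<close>

lemma mat_trace_anticommuting:
  assumes C: "C \<in> carrier_mat n n" "D \<in> carrier_mat n n" "D * D = 1\<^sub>m n"
    and CD: "C * D + D * C = 0\<^sub>m n n"
  shows "mat_trace C = 0"
proof -
  have "C * D = - (D * C)"
  proof (rule eq_matI)
    fix i j assume "i < dim_row (- (D * C))" "j < dim_col (- (D * C))"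
    then have ij: "i < n" "j < n" using C by auto
    have "(C * D + D * C) $$ (i, j) = 0" using CD ij by simp
    then show "(C * D) $$ (i, j) = (- (D * C)) $$ (i, j)"
      using ij C by (simp add: eq_neg_iff_add_eq_0 del: index_mult_mat(1))
  qed (use C in auto)
  then have 1: "D * (C * D) = - C"
  proof -
    have "D * (C * D) = - (D * (D * C))"
      using \<open>C * D = - (D * C)\<close> C by (simp add: uminus_mult_right_mat)
    also have "D * (D * C) = (D * D) * C"
      using C(1,2) by (simp add: assoc_mult_mat[of _ n n _ n _ n])
    finally show ?thesis using C by simp
  qed
  have "mat_trace C = mat_trace ((C * D) * D)"
    using C by (simp add: assoc_mult_mat[of _ n n _ n _ n])
  also have "\<dots> = mat_trace (D * (C * D))"
    by (rule mat_trace_mult_commute[of _ n n]) (use C in auto)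
  also have "\<dots> = - mat_trace C"
    unfolding 1 by (rule mat_trace_uminus[OF C(1)])
  finally show ?thesis by simp
qed

section \<open>Real combinations of anticommuting matrices\<close>

text \<open>This is \<open>\<Sum>\<^sub>l x\<^sub>l G\<^sub>l\<close> for anticommuting generators built from the top index down: those for
  \<open>k + 1\<close> are \<open>Z \<otimes> Id\<close> and \<open>X \<otimes> G\<^sub>l\<close>, \<open>l < k\<close>. Size \<open>2\<^sup>k\<close> instead of the optimal
  \<open>2\<^sup>k\<^sup>/\<^sup>2\<close> only affects the constant \<open>K\<close>.\<close>
fun clifford_sum :: "nat \<Rightarrow> (nat \<Rightarrow> real) \<Rightarrow> complex mat" where
  "clifford_sum 0 x = 0\<^sub>m 1 1"
| "clifford_sum (Suc k) x =
     four_block_mat (complex_of_real (x k) \<cdot>\<^sub>m 1\<^sub>m (2 ^ k)) (clifford_sum k x)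
       (clifford_sum k x) (complex_of_real (- x k) \<cdot>\<^sub>m 1\<^sub>m (2 ^ k))"

lemma clifford_sum_carrier [simp]: "clifford_sum k x \<in> carrier_mat (2 ^ k) (2 ^ k)"
  by (induction k) (auto simp: mult_2)

lemma clifford_sum_dim [simp]:
  "dim_row (clifford_sum k x) = 2 ^ k" "dim_col (clifford_sum k x) = 2 ^ k"
  using clifford_sum_carrier[of k x] by blast+

lemma hermitian_clifford_sum: "hermitian_mat (clifford_sum k x)"
proof (induction k)
  case 0
  show ?case by (rule hermitian_matI[of _ 1]) auto
next
  case (Suc k)
  show ?case
    by (rule hermitian_matI[OF clifford_sum_carrier])
      (use hermitian_mat_index[OF Suc clifford_sum_carrier] in auto)
qed

text \<open>The diagonal blocks are opposite multiples of the identity; \<open>sum.nat_group\<close>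
  cuts the diagonal into these two runs.\<close>

lemma mat_trace_clifford_sum: "mat_trace (clifford_sum k x) = 0"
proof (induction k)
  case (Suc k)
  let ?M = "clifford_sum (Suc k) x"
  have "mat_trace ?M = (\<Sum>i<2 ^ k + 2 ^ k. ?M $$ (i, i))"
    by (simp add: mat_trace_def)
  also have "\<dots> = (\<Sum>i<2 ^ k. ?M $$ (i, i)) + (\<Sum>i<2 ^ k. ?M $$ (i + 2 ^ k, i + 2 ^ k))"
    using sum.nat_group[of "\<lambda>i. ?M $$ (i, i)" "2 ^ k" 2] by (simp add: mult_2 lessThan_atLeast0 numeral_2_eq_2 sum.shift_bounds_nat_ivl[where m = 0, simplified])
  also have "\<dots> = 0" by simp
  finally show ?case .
qed (simp add: mat_trace_def)

text \<open>In the block products the scalars add 2 x_k y_k to the diagonal blocks inherited from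
  level k, while the off-diagonal blocks of the two products are negatives of each other. Inner
  products of vectors thereby become Gram entries of matrices.\<close>

lemma clifford_sum_anticommutator:
  "clifford_sum k x * clifford_sum k y + clifford_sum k y * clifford_sum k x
     = complex_of_real (2 * (\<Sum>l<k. x l * y l)) \<cdot>\<^sub>m 1\<^sub>m (2 ^ k)"
proof (induction k)
  case 0
  show ?case by (rule eq_matI) (auto simp: scalar_prod_def)
next
  case (Suc k)
  let ?n = "2 ^ k :: nat" and ?A = "clifford_sum k x" and ?B = "clifford_sum k y"
  let ?s = "complex_of_real (2 * (\<Sum>l<k. x l * y l))" and ?I = "1\<^sub>m ?n :: complex mat"
  let ?a = "complex_of_real (x k)" and ?b = "complex_of_real (y k)"
  have A: "?A \<in> carrier_mat ?n ?n" and B: "?B \<in> carrier_mat ?n ?n" by simp_all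
  have AB: "?A * ?B \<in> carrier_mat ?n ?n" "?B * ?A \<in> carrier_mat ?n ?n"
    using A B by (auto simp del: clifford_sum_carrier)
  have left: "(c \<cdot>\<^sub>m ?I) * M = c \<cdot>\<^sub>m M" and right: "M * (c \<cdot>\<^sub>m ?I) = c \<cdot>\<^sub>m M"
    if "M \<in> carrier_mat ?n ?n" for c M
    using that by (simp_all add: mult_smult_assoc_mat[of _ ?n ?n _ ?n] mult_smult_distrib[of _ ?n ?n _ ?n])
  have IH: "(?A * ?B) $$ (i, j) + (?B * ?A) $$ (i, j) = ?s * ?I $$ (i, j)" if "i < ?n" "j < ?n" for i j
  proof -
    have "(?A * ?B + ?B * ?A) $$ (i, j) = (?s \<cdot>\<^sub>m ?I) $$ (i, j)"
      by (rule arg_cong[where f = "\<lambda>M. M $$ (i, j)", OF Suc])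
    then show ?thesis using that AB by (simp del: index_mult_mat(1) index_one_mat(1))
  qed
  define AB where "AB = ?A * ?B"
  define BA where "BA = ?B * ?A"
  have carr: "AB \<in> carrier_mat ?n ?n" "BA \<in> carrier_mat ?n ?n"
    using AB by (simp_all add: AB_def BA_def)
  have prod: "clifford_sum (Suc k) x * clifford_sum (Suc k) y
      = four_block_mat (?a \<cdot>\<^sub>m (?b \<cdot>\<^sub>m ?I) + AB) (?a \<cdot>\<^sub>m ?B + (- ?b) \<cdot>\<^sub>m ?A)
          (?b \<cdot>\<^sub>m ?A + (- ?a) \<cdot>\<^sub>m ?B) (AB + (- ?a) \<cdot>\<^sub>m ((- ?b) \<cdot>\<^sub>m ?I))"
    by (simp add: mult_four_block_mat[of _ ?n ?n _ ?n _ ?n _ _ ?n _ ?n] left right AB_def smult_smult_mat mult.commute)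
  have prod': "clifford_sum (Suc k) y * clifford_sum (Suc k) x
      = four_block_mat (?b \<cdot>\<^sub>m (?a \<cdot>\<^sub>m ?I) + BA) (?b \<cdot>\<^sub>m ?A + (- ?a) \<cdot>\<^sub>m ?B)
          (?a \<cdot>\<^sub>m ?B + (- ?b) \<cdot>\<^sub>m ?A) (BA + (- ?b) \<cdot>\<^sub>m ((- ?a) \<cdot>\<^sub>m ?I))"
    by (simp add: mult_four_block_mat[of _ ?n ?n _ ?n _ ?n _ _ ?n _ ?n] left right BA_def smult_smult_mat mult.commute)
  define c where "c = ?s + 2 * (?a * ?b)"
  have sum: "AB $$ (i, j) + BA $$ (i, j) = ?s * ?I $$ (i, j)" if "i < ?n" "j < ?n" for i j
    using IH[OF that] unfolding AB_def BA_def .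
  have "complex_of_real (2 * (\<Sum>l<Suc k. x l * y l)) \<cdot>\<^sub>m 1\<^sub>m (2 ^ Suc k)
      = c \<cdot>\<^sub>m four_block_mat ?I (0\<^sub>m ?n ?n) (0\<^sub>m ?n ?n) ?I"
  proof -
    have "complex_of_real (2 * (\<Sum>l<Suc k. x l * y l)) = c"
      by (simp add: c_def distrib_left)
    then show ?thesis
      by (simp only: four_block_one_mat power_Suc mult_2)
  qed
  also have "\<dots> = four_block_mat (c \<cdot>\<^sub>m ?I) (0\<^sub>m ?n ?n) (0\<^sub>m ?n ?n) (c \<cdot>\<^sub>m ?I)"
    by (simp add: smult_four_block_mat[of _ ?n ?n _ ?n _ ?n] del: four_block_one_mat)
  finally have rhs: "complex_of_real (2 * (\<Sum>l<Suc k. x l * y l)) \<cdot>\<^sub>m 1\<^sub>m (2 ^ Suc k)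
      = four_block_mat (c \<cdot>\<^sub>m ?I) (0\<^sub>m ?n ?n) (0\<^sub>m ?n ?n) (c \<cdot>\<^sub>m ?I)" .
  have 1: "(?a \<cdot>\<^sub>m (?b \<cdot>\<^sub>m ?I) + AB) + (?b \<cdot>\<^sub>m (?a \<cdot>\<^sub>m ?I) + BA) = c \<cdot>\<^sub>m ?I" (is "?L = ?R")
  proof (rule eq_matI)
    fix i j assume "i < dim_row ?R" "j < dim_col ?R"
    then have ij: "i < ?n" "j < ?n" by auto
    have "?L $$ (i, j) = 2 * (?a * ?b) * ?I $$ (i, j) + (AB $$ (i, j) + BA $$ (i, j))"
      using ij carr by (simp add: algebra_simps del: index_one_mat(1))
    also have "\<dots> = ?R $$ (i, j)"
      unfolding sum[OF ij] using ij by (simp add: c_def distrib_right del: index_one_mat(1))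
    finally show "?L $$ (i, j) = ?R $$ (i, j)" .
  qed (use carr in auto)
  have 4: "(AB + (- ?a) \<cdot>\<^sub>m ((- ?b) \<cdot>\<^sub>m ?I)) + (BA + (- ?b) \<cdot>\<^sub>m ((- ?a) \<cdot>\<^sub>m ?I)) = c \<cdot>\<^sub>m ?I" (is "?L = ?R")
  proof (rule eq_matI)
    fix i j assume "i < dim_row ?R" "j < dim_col ?R"
    then have ij: "i < ?n" "j < ?n" by auto
    have "?L $$ (i, j) = 2 * (?a * ?b) * ?I $$ (i, j) + (AB $$ (i, j) + BA $$ (i, j))"
      using ij carr by (simp add: algebra_simps del: index_one_mat(1))
    also have "\<dots> = ?R $$ (i, j)"
      unfolding sum[OF ij] using ij by (simp add: c_def distrib_right del: index_one_mat(1))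
    finally show "?L $$ (i, j) = ?R $$ (i, j)" .
  qed (use carr in auto)
  have 2: "(?a \<cdot>\<^sub>m ?B + (- ?b) \<cdot>\<^sub>m ?A) + (?b \<cdot>\<^sub>m ?A + (- ?a) \<cdot>\<^sub>m ?B) = 0\<^sub>m ?n ?n"
    and 3: "(?b \<cdot>\<^sub>m ?A + (- ?a) \<cdot>\<^sub>m ?B) + (?a \<cdot>\<^sub>m ?B + (- ?b) \<cdot>\<^sub>m ?A) = 0\<^sub>m ?n ?n"
    by (rule eq_matI, auto)+
  show ?case
    unfolding prod prod' rhs
    by (subst add_four_block_mat[of _ ?n ?n _ ?n _ ?n])
      (use carr in \<open>simp_all add: 1 2 3 4\<close>)
qed


section \<open>The metric space of a family of reflections\<close>

text \<open>The Gram matrix \<open>g\<close> is a parameter so that one distance formula covers the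
  given matrices and their replacements in another dimension. The case k = l makes each
  \<open>T k\<close> an involution, and the bound on \<open>g\<close> keeps the radicand (1 - g)/2
  nonnegative.\<close>

definition reflection_family ::
  "nat \<Rightarrow> nat \<Rightarrow> (nat \<Rightarrow> complex mat) \<Rightarrow> (nat \<Rightarrow> nat \<Rightarrow> real) \<Rightarrow> bool" where
  "reflection_family m N T g \<longleftrightarrow>
     (\<forall>k<N. T k \<in> carrier_mat m m \<and> hermitian_mat (T k) \<and> mat_trace (T k) = 0 \<and> g k k = 1) \<and>
     (\<forall>k<N. \<forall>l<N. \<bar>g k l\<bar> \<le> 1 \<and>
        T k * T l + T l * T k = complex_of_real (2 * g k l) \<cdot>\<^sub>m 1\<^sub>m m)"

lemma reflection_family_square:
  assumes "reflection_family m N T g" "k < N"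
  shows "T k * T k = 1\<^sub>m m"
proof (rule eq_matI)
  have T: "T k \<in> carrier_mat m m"
    and *: "T k * T k + T k * T k = complex_of_real 2 \<cdot>\<^sub>m 1\<^sub>m m"
    using assms unfolding reflection_family_def by fastforce+
  fix i j assume "i < dim_row (1\<^sub>m m :: complex mat)" "j < dim_col (1\<^sub>m m :: complex mat)"
  then have ij: "i < m" "j < m" by auto
  have "(T k * T k + T k * T k) $$ (i, j) = (complex_of_real 2 \<cdot>\<^sub>m 1\<^sub>m m) $$ (i, j)"
    by (simp only: *)
  then show "(T k * T k) $$ (i, j) = 1\<^sub>m m $$ (i, j)"
    using T ij by (simp del: index_mult_mat(1) index_one_mat(1))
qed (use assms in \<open>auto simp: reflection_family_def\<close>)

text \<open>A common index set of size N + 2 lets two spaces be compared index by index; the shift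
  by 2 makes room for 0 and Id. Normalisation stays outside, because the image also carries a
  shrinking factor.\<close>

definition reflection_point :: "nat \<Rightarrow> (nat \<Rightarrow> complex mat) \<Rightarrow> nat \<Rightarrow> complex mat" where
  "reflection_point m T a =
     (if a = 0 then 0\<^sub>m m m else if a = 1 then 1\<^sub>m m else (1/2) \<cdot>\<^sub>m (1\<^sub>m m + T (a - 2)))"

text \<open>Distances after division by the dimension: 1 and 1/2 are the normalised traces of Id and
  of the projections, and sqrt((1 - g)/2) is the only singular value of half the difference of two
  reflections.\<close>

definition reflection_dist :: "(nat \<Rightarrow> nat \<Rightarrow> real) \<Rightarrow> nat \<Rightarrow> nat \<Rightarrow> real" where
  "reflection_dist g a b =
     (if a < 2 \<and> b < 2 then (if a = b then 0 else 1)
      else if a < 2 \<or> b < 2 then 1/2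
      else sqrt ((1 - g (a - 2) (b - 2)) / 2))"

text \<open>T^2 = Id gives (Id + T)^2 = 2(Id + T), so half of Id + T is a projection; its trace is
  m/2 because \<open>T\<close> is trace-free.\<close>

lemma schatten1_norm_half_reflection:
  assumes T: "T \<in> carrier_mat m m" "hermitian_mat T" "mat_trace T = 0" "T * T = 1\<^sub>m m" and r: "r \<ge> 0"
  shows "schatten1_norm (complex_of_real r \<cdot>\<^sub>m ((1/2) \<cdot>\<^sub>m (1\<^sub>m m + T))) = r * m * (1/2)"
proof -
  let ?P = "(1/2) \<cdot>\<^sub>m (1\<^sub>m m + T)"
  have E: "1\<^sub>m m + T \<in> carrier_mat m m" "hermitian_mat (1\<^sub>m m + T)"
    using T by (auto intro: hermitian_mat_add[of _ m])
  have P: "?P \<in> carrier_mat m m" "hermitian_mat ?P"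
    using E hermitian_mat_smult[OF E, of "1/2"] by auto
  have "(1\<^sub>m m + T) * (1\<^sub>m m + T) = (1\<^sub>m m + T) + (T + 1\<^sub>m m)"
    using T by (simp add: mult_add_distrib_mat[of _ m m _ m] add_mult_distrib_mat[of _ m m _ _ m])
  then have "?P * ?P = (1/2) \<cdot>\<^sub>m ((1/2) \<cdot>\<^sub>m ((1\<^sub>m m + T) + (T + 1\<^sub>m m)))"
    using E(1) by (simp add: mult_smult_distrib[of _ m m _ m] mult_smult_assoc_mat[of _ m m _ m])
  also have "\<dots> = ?P"
    by (rule eq_matI) (use T in auto)
  finally have "?P * ?P = ?P" .
  moreover have "Re (mat_trace ?P) = m * (1/2)"
    using T by (simp add: mat_trace_smult[of _ m] mat_trace_add[of _ m])
  ultimately show ?thesis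
    using schatten1_norm_projection[OF P _ r] by simp
qed

lemma schatten1_norm_half_reflection_diff:
  assumes T: "reflection_family m N T g" "k < N" "l < N" and r: "r \<ge> 0"
  shows "schatten1_norm (complex_of_real r \<cdot>\<^sub>m ((1/2) \<cdot>\<^sub>m (1\<^sub>m m + T k) - (1/2) \<cdot>\<^sub>m (1\<^sub>m m + T l)))
    = r * m * sqrt ((1 - g k l) / 2)"
proof -
  let ?U = "(1/2) \<cdot>\<^sub>m (T k - T l)"
  have c: "T k \<in> carrier_mat m m" "T l \<in> carrier_mat m m" and h: "hermitian_mat (T k)" "hermitian_mat (T l)"
    and g: "\<bar>g k l\<bar> \<le> 1"
    and anti: "T k * T l + T l * T k = complex_of_real (2 * g k l) \<cdot>\<^sub>m 1\<^sub>m m"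
    using T unfolding reflection_family_def by auto
  note sq = reflection_family_square[OF T(1)]
  have D: "T k - T l \<in> carrier_mat m m" "hermitian_mat (T k - T l)"
    using c h by (auto intro: hermitian_mat_minus[of _ m] simp: minus_carrier_mat)
  have U: "?U \<in> carrier_mat m m" "hermitian_mat ?U"
    using D hermitian_mat_smult[OF D, of "1/2"] by auto
  have "(T k - T l) * (T k - T l) = (1\<^sub>m m - T l * T k) - (T k * T l - 1\<^sub>m m)"
    using c T sq by (simp add: mult_minus_distrib_mat[of _ m m _ m] minus_mult_distrib_mat[of _ m m _ _ m] minus_carrier_mat)
  also have "\<dots> = complex_of_real 2 \<cdot>\<^sub>m 1\<^sub>m m - (T k * T l + T l * T k)"
    by (rule eq_matI) (use c in auto)
  also have "\<dots> = complex_of_real (2 * (1 - g k l)) \<cdot>\<^sub>m 1\<^sub>m m"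
    unfolding anti by (rule eq_matI) (auto simp: algebra_simps)
  finally have "?U * ?U = (1/2) \<cdot>\<^sub>m ((1/2) \<cdot>\<^sub>m (complex_of_real (2 * (1 - g k l)) \<cdot>\<^sub>m 1\<^sub>m m))"
    using D(1) by (simp add: mult_smult_distrib[of _ m m _ m] mult_smult_assoc_mat[of _ m m _ m])
  also have "\<dots> = complex_of_real ((1 - g k l) / 2) \<cdot>\<^sub>m 1\<^sub>m m"
    by (rule eq_matI) (auto simp: field_simps)
  finally have "schatten1_norm (complex_of_real r \<cdot>\<^sub>m ?U) = r * (sqrt ((1 - g k l) / 2) * m)"
    by (intro schatten1_norm_scalar_square U r) (use g in auto)
  moreover have "(1/2) \<cdot>\<^sub>m (1\<^sub>m m + T k) - (1/2) \<cdot>\<^sub>m (1\<^sub>m m + T l) = ?U"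
    by (rule eq_matI) (use c in \<open>auto simp: algebra_simps\<close>)
  ultimately show ?thesis by simp
qed

lemma reflection_point_carrier:
  assumes "reflection_family m N T g" "a < N + 2"
  shows "reflection_point m T a \<in> carrier_mat m m"
  using assms by (auto simp: reflection_point_def reflection_family_def)

text \<open>Listing the larger index first halves the cases; \<open>reflection_dist_commute\<close>
  and \<open>schatten1_norm_minus_commute\<close> supply the other order.\<close>

lemma schatten1_norm_reflection_point_diff_aux:
  assumes T: "reflection_family m N T g" and b: "b < N + 2" and r: "r \<ge> 0" and le: "a \<le> b"
  shows "schatten1_norm (complex_of_real r \<cdot>\<^sub>m (reflection_point m T b - reflection_point m T a))
    = r * m * reflection_dist g b a"
proof -
  consider "a = b" "b < 2" | "a = 0" "b = 1" | "a = 0" "b \<ge> 2" | "a = 1" "b \<ge> 2" | "a \<ge> 2"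
    using le by linarith
  then show ?thesis
  proof cases
    case 1
    have "complex_of_real r \<cdot>\<^sub>m (reflection_point m T b - reflection_point m T b) = 0\<^sub>m m m"
      using reflection_point_carrier[OF T b] by auto
    then show ?thesis using 1 by (simp add: reflection_dist_def)
  next
    case 2
    have "1\<^sub>m m - 0\<^sub>m m m = (1\<^sub>m m :: complex mat)" by (rule eq_matI) auto
    then show ?thesis
      using 2 schatten1_norm_projection[of "1\<^sub>m m" m r] r
      by (simp add: reflection_point_def reflection_dist_def)
  next
    case 3
    then have k: "b - 2 < N" using b by auto
    have c: "T (b - 2) \<in> carrier_mat m m" using T k by (auto simp: reflection_family_def)
    have "(1/2) \<cdot>\<^sub>m (1\<^sub>m m + T (b - 2)) - 0\<^sub>m m m = (1/2) \<cdot>\<^sub>m (1\<^sub>m m + T (b - 2))"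
      by (rule eq_matI) (use c in auto)
    then show ?thesis
      using 3 schatten1_norm_half_reflection[OF c _ _ reflection_family_square[OF T k] r] T k
      by (simp add: reflection_point_def reflection_dist_def reflection_family_def)
  next
    case 4
    then have k: "b - 2 < N" using b by auto
    have c: "T (b - 2) \<in> carrier_mat m m" "hermitian_mat (T (b - 2))" "mat_trace (T (b - 2)) = 0"
      using T k by (auto simp: reflection_family_def)
    have sq: "- T (b - 2) * - T (b - 2) = 1\<^sub>m m"
      using c reflection_family_square[OF T k] by (simp add: uminus_mult_left_mat uminus_mult_right_mat)
    \<comment> \<open>The difference from Id is minus the projection attached to
      \<open>- T (b - 2)\<close>, again a trace-free reflection.\<close>
    have "complex_of_real r \<cdot>\<^sub>m ((1/2) \<cdot>\<^sub>m (1\<^sub>m m + T (b - 2)) - 1\<^sub>m m)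
        = - (complex_of_real r \<cdot>\<^sub>m ((1/2) \<cdot>\<^sub>m (1\<^sub>m m + - T (b - 2))))"
      by (rule eq_matI) (use c in \<open>auto simp: field_simps\<close>)
    moreover have "complex_of_real r \<cdot>\<^sub>m ((1/2) \<cdot>\<^sub>m (1\<^sub>m m + - T (b - 2))) \<in> carrier_mat m m"
      using c by auto
    ultimately show ?thesis
      using 4 schatten1_norm_half_reflection[OF _ _ _ sq r] c
      by (simp add: reflection_point_def reflection_dist_def schatten1_norm_uminus[of _ m]
          mat_trace_uminus[of _ m] hermitian_mat_uminus[of _ m])
  next
    case 5
    then have k: "b - 2 < N" "a - 2 < N" using b le by auto
    then show ?thesis
      using 5 le schatten1_norm_half_reflection_diff[OF T k r]
      by (simp add: reflection_point_def reflection_dist_def)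
  qed
qed

text \<open>The anticommutator is symmetric in its two matrices, so comparing one entry shows that
  \<open>g\<close> is symmetric; m > 0 ensures that the entry (0, 0) exists.\<close>

lemma reflection_dist_commute:
  assumes T: "reflection_family m N T g" and ab: "a < N + 2" "b < N + 2" and m: "m > 0"
  shows "reflection_dist g a b = reflection_dist g b a"
proof (cases "a < 2 \<or> b < 2")
  case True
  then show ?thesis by (auto simp: reflection_dist_def)
next
  case False
  let ?k = "a - 2" and ?l = "b - 2"
  have kl: "?k < N" "?l < N" using False ab by auto
  then have c: "T ?k \<in> carrier_mat m m" "T ?l \<in> carrier_mat m m"
    and 1: "T ?k * T ?l + T ?l * T ?k = complex_of_real (2 * g ?k ?l) \<cdot>\<^sub>m 1\<^sub>m m"
    and 2: "T ?l * T ?k + T ?k * T ?l = complex_of_real (2 * g ?l ?k) \<cdot>\<^sub>m 1\<^sub>m m"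
    using T unfolding reflection_family_def by auto
  have "T ?k * T ?l + T ?l * T ?k = T ?l * T ?k + T ?k * T ?l"
    using c by (intro comm_add_mat[of _ m m]) auto
  then have "(complex_of_real (2 * g ?k ?l) \<cdot>\<^sub>m 1\<^sub>m m) $$ (0, 0)
      = (complex_of_real (2 * g ?l ?k) \<cdot>\<^sub>m 1\<^sub>m m) $$ (0, 0)"
    unfolding 1 2 by simp
  then have "g ?k ?l = g ?l ?k" using m by simp
  then show ?thesis using False by (simp add: reflection_dist_def)
qed

lemma schatten1_norm_reflection_point_diff:
  assumes T: "reflection_family m N T g" and ab: "a < N + 2" "b < N + 2"
    and r: "r \<ge> 0" and m: "m > 0"
  shows "schatten1_norm (complex_of_real r \<cdot>\<^sub>m reflection_point m T a
      - complex_of_real r \<cdot>\<^sub>m reflection_point m T b) = r * m * reflection_dist g a b"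
proof -
  let ?p = "reflection_point m T" and ?r = "complex_of_real r"
  have c: "?p a \<in> carrier_mat m m" "?p b \<in> carrier_mat m m"
    using reflection_point_carrier[OF T] ab by auto
  have distrib: "?r \<cdot>\<^sub>m (A - B) = ?r \<cdot>\<^sub>m A - ?r \<cdot>\<^sub>m B"
    if "A \<in> carrier_mat m m" "B \<in> carrier_mat m m" for A B
    by (rule eq_matI) (use that in \<open>auto simp: algebra_simps\<close>)
  show ?thesis
  proof (cases "a \<le> b")
    case True
    have "schatten1_norm (?r \<cdot>\<^sub>m ?p a - ?r \<cdot>\<^sub>m ?p b) = schatten1_norm (?r \<cdot>\<^sub>m (?p b - ?p a))"
      using c schatten1_norm_minus_commute[of "?r \<cdot>\<^sub>m ?p a" m "?r \<cdot>\<^sub>m ?p b"] by (simp add: distrib)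
    then show ?thesis
      using schatten1_norm_reflection_point_diff_aux[OF T ab(2) r True]
        reflection_dist_commute[OF T ab m] by simp
  next
    case False
    then show ?thesis
      using schatten1_norm_reflection_point_diff_aux[OF T ab(1) r, of b] c by (simp add: distrib)
  qed
qed


text \<open>The doubled family lists \<open>H\<^sub>0, \<dots>, H\<^sub>n\<^sub>-\<^sub>1, -H\<^sub>0, \<dots>, -H\<^sub>n\<^sub>-\<^sub>1\<close>, so that \<open>(Id + T\<^sub>k)/2\<close> runs
  through both spectral projections of every \<open>H\<^sub>i\<close>.\<close>
definition double_index :: "nat \<Rightarrow> nat \<Rightarrow> nat" where
  "double_index n k = (if k < n then k else k - n)"

definition double_sign :: "nat \<Rightarrow> nat \<Rightarrow> real" where
  "double_sign n k = (if k < n then 1 else - 1)"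

text \<open>Signs pull out of the anticommutator by bilinearity, so Gram entries are multiplied by
  s_k s_l; the diagonal stays 1 because signs square to 1.\<close>

lemma reflection_family_signed_double:
  assumes H: "reflection_family m n H h"
  defines "i \<equiv> double_index n" and "s \<equiv> double_sign n"
  shows "reflection_family m (2 * n) (\<lambda>k. complex_of_real (s k) \<cdot>\<^sub>m H (i k)) (\<lambda>k l. s k * s l * h (i k) (i l))"
proof -
  have i: "i k < n" if "k < 2 * n" for k using that by (auto simp: i_def double_index_def)
  have ss: "s k * s k = 1" and s1: "\<bar>s k\<bar> = 1" for k by (auto simp: s_def double_sign_def)
  have anti: "complex_of_real (s k) \<cdot>\<^sub>m H (i k) * (complex_of_real (s l) \<cdot>\<^sub>m H (i l))
      + complex_of_real (s l) \<cdot>\<^sub>m H (i l) * (complex_of_real (s k) \<cdot>\<^sub>m H (i k))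
      = complex_of_real (2 * (s k * s l * h (i k) (i l))) \<cdot>\<^sub>m 1\<^sub>m m"
    if "k < 2 * n" "l < 2 * n" for k l
  proof -
    have c: "H (i k) \<in> carrier_mat m m" "H (i l) \<in> carrier_mat m m"
      and *: "H (i k) * H (i l) + H (i l) * H (i k) = complex_of_real (2 * h (i k) (i l)) \<cdot>\<^sub>m 1\<^sub>m m"
      using H i[OF that(1)] i[OF that(2)] unfolding reflection_family_def by auto
    have "complex_of_real (s k) \<cdot>\<^sub>m H (i k) * (complex_of_real (s l) \<cdot>\<^sub>m H (i l))
        + complex_of_real (s l) \<cdot>\<^sub>m H (i l) * (complex_of_real (s k) \<cdot>\<^sub>m H (i k))
        = complex_of_real (s k * s l) \<cdot>\<^sub>m (H (i k) * H (i l) + H (i l) * H (i k))"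
      using c by (simp add: mult_smult_distrib[of _ m m _ m] mult_smult_assoc_mat[of _ m m _ m]
          smult_smult_mat add_smult_distrib_left_mat[of _ m m] mult.commute)
    also have "\<dots> = complex_of_real (2 * (s k * s l * h (i k) (i l))) \<cdot>\<^sub>m 1\<^sub>m m"
      unfolding * smult_smult_mat by (simp add: mult_ac)
    finally show ?thesis .
  qed
  show ?thesis
    unfolding reflection_family_def
  proof (intro conjI allI impI)
    fix k assume "k < 2 * n"
    then have Hk: "H (i k) \<in> carrier_mat m m" "hermitian_mat (H (i k))" "mat_trace (H (i k)) = 0" "h (i k) (i k) = 1"
      using H i[of k] unfolding reflection_family_def by auto
    show "complex_of_real (s k) \<cdot>\<^sub>m H (i k) \<in> carrier_mat m m" using Hk by simp
    show "hermitian_mat (complex_of_real (s k) \<cdot>\<^sub>m H (i k))" using Hk by (simp add: hermitian_mat_smult)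
    show "mat_trace (complex_of_real (s k) \<cdot>\<^sub>m H (i k)) = 0" using Hk by (simp add: mat_trace_smult)
    show "s k * s k * h (i k) (i k) = 1" using Hk ss by simp
  next
    fix k l assume kl: "k < 2 * n" "l < 2 * n"
    show "\<bar>s k * s l * h (i k) (i l)\<bar> \<le> 1"
      using H i[OF kl(1)] i[OF kl(2)] unfolding reflection_family_def by (simp add: abs_mult s1)
  qed (rule anti)
qed

text \<open>With n \<ge> 2 each matrix has a partner to which \<open>mat_trace_anticommuting\<close>
  applies. \<open>Suc\<close> passes from indices starting at 1 to indices starting at 0.\<close>

lemma reflection_family_anticommuting:
  assumes n: "n \<ge> 2"
    and C: "\<And>i. i \<in> {1..n} \<Longrightarrow> C i \<in> carrier_mat m m \<and> hermitian_mat (C i) \<and> C i * C i = 1\<^sub>m m"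
    and anti: "\<And>i j. i \<in> {1..n} \<Longrightarrow> j \<in> {1..n} \<Longrightarrow> i \<noteq> j \<Longrightarrow> C i * C j + C j * C i = 0\<^sub>m m m"
  shows "reflection_family m n (\<lambda>i. C (Suc i)) (\<lambda>i j. if i = j then 1 else 0)"
  unfolding reflection_family_def
proof (intro conjI allI impI)
  fix i assume i: "i < n"
  then show "C (Suc i) \<in> carrier_mat m m" "hermitian_mat (C (Suc i))" using C[of "Suc i"] by auto
  obtain j where j: "j \<in> {1..n}" "j \<noteq> Suc i"
    using n by (metis One_nat_def Suc_1 Suc_leD atLeastAtMost_iff le_refl n_not_Suc_n)
  show "mat_trace (C (Suc i)) = 0"
    using mat_trace_anticommuting[of "C (Suc i)" m "C j"] C[of "Suc i"] C[of j] j anti[of "Suc i" j] i by auto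
next
  fix i j assume ij: "i < n" "j < n"
  show "C (Suc i) * C (Suc j) + C (Suc j) * C (Suc i)
      = complex_of_real (2 * (if i = j then 1 else 0)) \<cdot>\<^sub>m 1\<^sub>m m"
  proof (cases "i = j")
    case True
    have "1\<^sub>m m + 1\<^sub>m m = (2 \<cdot>\<^sub>m 1\<^sub>m m :: complex mat)" by (rule eq_matI) auto
    then show ?thesis using C[of "Suc i"] ij True by simp
  next
    case False
    have "0\<^sub>m m m = (0 \<cdot>\<^sub>m 1\<^sub>m m :: complex mat)" by (rule eq_matI) auto
    then show ?thesis using anti[of "Suc i" "Suc j"] ij False by simp
  qed
qed auto

lemma reflection_family_clifford_sum:
  assumes x: "\<And>i. i < n \<Longrightarrow> (\<Sum>l<k. x i l * x i l) = 1"
    and le: "\<And>i j. i < n \<Longrightarrow> j < n \<Longrightarrow> \<bar>\<Sum>l<k. x i l * x j l\<bar> \<le> 1"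
  shows "reflection_family (2 ^ k) n (\<lambda>i. clifford_sum k (x i)) (\<lambda>i j. \<Sum>l<k. x i l * x j l)"
  unfolding reflection_family_def
  using assms by (auto simp: hermitian_clifford_sum mat_trace_clifford_sum clifford_sum_anticommutator)

lemma embeds_S1_reflection_points:
  assumes T: "reflection_family m N T g" and T': "reflection_family d N T' g'"
    and md: "m > 0" "d > 0" and s: "s \<ge> 0"
    and le: "\<And>a b. a < N + 2 \<Longrightarrow> b < N + 2 \<Longrightarrow>
      s * reflection_dist g' a b \<le> reflection_dist g a b \<and>
      reflection_dist g a b \<le> D * (s * reflection_dist g' a b)"
  shows "embeds_S1 (map (\<lambda>a. (1 / of_nat m) \<cdot>\<^sub>m reflection_point m T a) [0..<N + 2]) d D"
proof -
  let ?As = "map (\<lambda>a. (1 / of_nat m) \<cdot>\<^sub>m reflection_point m T a) [0..<N + 2]"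
  \<comment> \<open>Division by \<open>d\<close> normalises the trace; \<open>s\<close> is the
    shrinking that keeps the map from expanding.\<close>
  let ?Bs = "map (\<lambda>a. complex_of_real (s / d) \<cdot>\<^sub>m reflection_point d T' a) [0..<N + 2]"
  have A: "schatten1_norm (?As ! a - ?As ! b) = reflection_dist g a b" if "a < N + 2" "b < N + 2" for a b
  proof -
    have "1 / of_nat m = complex_of_real (1 / m)" by simp
    then have "schatten1_norm (?As ! a - ?As ! b) = 1 / m * m * reflection_dist g a b"
      using that schatten1_norm_reflection_point_diff[OF T that _ md(1), of "1 / m"]
      by (simp del: upt_Suc)
    then show ?thesis using md by simp
  qed
  have B: "schatten1_norm (?Bs ! a - ?Bs ! b) = s * reflection_dist g' a b" if "a < N + 2" "b < N + 2" for a b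
  proof -
    have "schatten1_norm (?Bs ! a - ?Bs ! b) = s / d * d * reflection_dist g' a b"
      using that schatten1_norm_reflection_point_diff[OF T' that _ md(2), of "s / d"] s
      by (simp del: upt_Suc of_real_divide)
    then show ?thesis using md by simp
  qed
  show ?thesis
    unfolding embeds_S1_def
  proof (intro exI[of _ ?Bs] conjI allI impI)
    show "set ?Bs \<subseteq> carrier_mat d d"
      using reflection_point_carrier[OF T'] by auto
  qed (use A B le in auto)
qed

text \<open>Distances involving 0 or Id, or between points belonging to one matrix, agree for
  \<open>g\<close> and \<open>g'\<close>. The others compare sqrt(1/2) with sqrt((1 - g')/2), where
  |g'| \<le> \<delta>/2; \<open>s\<close> brings the largest value allowed, sqrt((1 +
  \<delta>/2)/2), down to sqrt(1/2).\<close>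

lemma reflection_dist_distortion:
  fixes \<delta> :: real and h :: "nat \<Rightarrow> nat \<Rightarrow> real"
  assumes \<delta>: "0 < \<delta>" "\<delta> < 1"
    and h: "\<And>i. i < n \<Longrightarrow> h i i = 1"
      "\<And>i j. i < n \<Longrightarrow> j < n \<Longrightarrow> i \<noteq> j \<Longrightarrow> \<bar>h i j\<bar> \<le> \<delta> / 2"
    and ab: "a < 2 * n + 2" "b < 2 * n + 2"
  defines "idx \<equiv> double_index n" and "sg \<equiv> double_sign n"
    and "s \<equiv> 1 / sqrt (1 + \<delta> / 2)"
  defines "g \<equiv> \<lambda>k l. sg k * sg l * (if idx k = idx l then 1 else 0)"
    and "g' \<equiv> \<lambda>k l. sg k * sg l * h (idx k) (idx l)"
  shows "s * reflection_dist g' a b \<le> reflection_dist g a b \<and>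
    reflection_dist g a b \<le> (1 + \<delta>) * (s * reflection_dist g' a b)"
proof -
  have s: "0 < s" "s \<le> 1" using \<delta> by (auto simp: s_def)
  have "1 + \<delta> / 2 \<le> (1 + \<delta>)\<^sup>2"
    using \<delta> by (simp add: power2_eq_square algebra_simps)
  then have "sqrt (1 + \<delta> / 2) \<le> 1 + \<delta>"
    using \<delta> by (simp add: real_le_lsqrt)
  then have s1: "1 \<le> (1 + \<delta>) * s"
    using \<delta> by (simp add: s_def field_simps)
  have same: "s * t \<le> t \<and> t \<le> (1 + \<delta>) * (s * t)" if "t \<ge> 0" for t
    using mult_right_mono[OF s(2) that] mult_right_mono[OF s1 that] by (simp add: mult_ac)
  show ?thesis
  proof (cases "a < 2 \<or> b < 2")
    case True
    then have "reflection_dist g' a b = reflection_dist g a b" "reflection_dist g a b \<ge> 0"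
      by (auto simp: reflection_dist_def)
    then show ?thesis using same by simp
  next
    case False
    let ?k = "a - 2" and ?l = "b - 2"
    have kl: "idx ?k < n" "idx ?l < n" using ab False by (auto simp: idx_def double_index_def)
    have d: "reflection_dist g a b = sqrt ((1 - g ?k ?l) / 2)"
      "reflection_dist g' a b = sqrt ((1 - g' ?k ?l) / 2)"
      using False by (auto simp: reflection_dist_def)
    show ?thesis
    proof (cases "idx ?k = idx ?l")
      case True
      then have "g' ?k ?l = g ?k ?l" "\<bar>g ?k ?l\<bar> \<le> 1"
        using h(1)[OF kl(1)] by (auto simp: g_def g'_def sg_def double_sign_def)
      then show ?thesis unfolding d using same by simp
    next
      case ne: False
      have g: "g ?k ?l = 0" using ne by (simp add: g_def)
      have "\<bar>g' ?k ?l\<bar> = \<bar>h (idx ?k) (idx ?l)\<bar>"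
        by (auto simp: g'_def sg_def double_sign_def)
      then have g': "\<bar>g' ?k ?l\<bar> \<le> \<delta> / 2" using h(2)[OF kl ne] by simp
      let ?y = "1 - g' ?k ?l"
      have y: "1 - \<delta> / 2 \<le> ?y" "?y \<le> 1 + \<delta> / 2" using g' by linarith+
      have sd: "s * sqrt (?y / 2) = sqrt (?y / (1 + \<delta> / 2) / 2)"
        by (simp only: s_def real_sqrt_divide) simp
      have "?y / (1 + \<delta> / 2) \<le> 1" using y \<delta> by (simp add: field_simps)
      then have up: "s * sqrt (?y / 2) \<le> sqrt (1 / 2)"
        unfolding sd by (intro real_sqrt_le_mono divide_right_mono) auto
      have "0 \<le> 1 - \<delta>\<^sup>2" using \<delta> by (simp add: abs_square_le_1)
      \<comment> \<open>This product is exactly the difference of the two sides of the next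
        inequality, the worst case ?y = 1 - \<delta>/2.\<close>
      then have "0 \<le> \<delta> * (1 - \<delta>\<^sup>2 / 2)" using \<delta> by simp
      then have "1 + \<delta> / 2 \<le> (1 + \<delta>)\<^sup>2 * (1 - \<delta> / 2)"
        by (simp add: power2_eq_square algebra_simps)
      also have "\<dots> \<le> (1 + \<delta>)\<^sup>2 * ?y"
        using y by (intro mult_left_mono) auto
      finally have "1 \<le> (1 + \<delta>)\<^sup>2 * (?y / (1 + \<delta> / 2))"
        using \<delta> by (simp add: field_simps)
      then have "sqrt (1 / 2) \<le> sqrt ((1 + \<delta>)\<^sup>2 * (?y / (1 + \<delta> / 2)) / 2)"
        by (intro real_sqrt_le_mono divide_right_mono) auto
      also have "\<dots> = sqrt ((1 + \<delta>)\<^sup>2 * (?y / (1 + \<delta> / 2) / 2))"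
        by (simp only: times_divide_eq_right)
      also have "\<dots> = (1 + \<delta>) * (s * sqrt (?y / 2))"
        unfolding sd using \<delta> by (simp add: real_sqrt_mult del: times_divide_eq_right)
      finally show ?thesis
        unfolding d g using up by simp
    qed
  qed
qed

section \<open>The embedding\<close>

text \<open>At t = \<delta>/2 the Chernoff exponent is k \<delta>^2/8, so k \<ge> 8
  ln(4n)/\<delta>^2 brings the failure bound down to 2n/(4n) = 1/2. Rounding up costs at most 1, and
  ln(4n) \<le> 3 ln n and 1 \<le> 2 ln n for n \<ge> 2, whence 26 = 8 * 3 + 2.\<close>

lemma exists_clifford_dimension:
  fixes \<delta> :: real
  assumes n: "n \<ge> 2" and \<delta>: "0 < \<delta>" "\<delta> < 1"
  shows "\<exists>k>0. 2 * real n * exp (- (k * (\<delta> / 2)\<^sup>2 / 2)) < 1 \<and> 2 ^ k \<le> real n powr (26 / \<delta>\<^sup>2)"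
proof -
  define k where "k = nat \<lceil>8 * ln (4 * real n) / \<delta>\<^sup>2\<rceil>"
  have ln_pos: "ln (4 * real n) > 0" using n by simp
  then have q: "8 * ln (4 * real n) / \<delta>\<^sup>2 > 0" using \<delta> by simp
  then have "k > 0" by (simp add: k_def)
  have k1: "8 * ln (4 * real n) / \<delta>\<^sup>2 \<le> k" unfolding k_def by linarith
  have k2: "k \<le> 8 * ln (4 * real n) / \<delta>\<^sup>2 + 1" using q unfolding k_def by linarith
  have "ln (4 * real n) \<le> k * (\<delta> / 2)\<^sup>2 / 2"
    using k1 \<delta> by (simp add: field_simps)
  then have "exp (- (k * (\<delta> / 2)\<^sup>2 / 2)) \<le> exp (- ln (4 * real n))" by simp
  also have "\<dots> = 1 / (4 * real n)" using n by (simp add: exp_minus field_simps)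
  finally have "2 * real n * exp (- (k * (\<delta> / 2)\<^sup>2 / 2)) \<le> 2 * real n * (1 / (4 * real n))"
    by (intro mult_left_mono) auto
  also have "\<dots> < 1" using n by simp
  finally have small: "2 * real n * exp (- (k * (\<delta> / 2)\<^sup>2 / 2)) < 1" .
  have "ln 2 \<ge> (1/2 :: real)" using ln_le_minus_one[of "1/2"] by (simp add: ln_div)
  moreover have ln2: "ln 2 \<le> ln (real n)" using n by simp
  ultimately have ln1: "1 \<le> 2 * ln (real n)" by linarith
  have ln4: "ln (4 * real n) \<le> 3 * ln (real n)"
  proof -
    have "ln (4 * real n) = 2 * ln 2 + ln (real n)"
      using n ln_realpow[of 2 2] by (simp add: ln_mult)
    then show ?thesis using ln2 by linarith
  qed
  have "\<delta>\<^sup>2 \<le> 1" using \<delta> by (simp add: abs_square_le_1)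
  have "real k * \<delta>\<^sup>2 \<le> 8 * ln (4 * real n) + \<delta>\<^sup>2"
    using k2 \<delta> by (simp add: field_simps)
  then have "real k * \<delta>\<^sup>2 \<le> 26 * ln (real n)"
    using \<open>\<delta>\<^sup>2 \<le> 1\<close> ln1 ln4 by linarith
  then have "real k \<le> 26 / \<delta>\<^sup>2 * ln (real n)"
    using \<delta> by (simp add: field_simps)
  \<comment> \<open>The crude estimate 2^k \<le> e^k suffices.\<close>
  moreover have "real k * ln 2 \<le> real k * 1"
    using ln_2_less_1 by (intro mult_left_mono) auto
  ultimately have "exp (real k * ln 2) \<le> exp (26 / \<delta>\<^sup>2 * ln (real n))"
    by simp
  moreover have "exp (real k * ln 2) = 2 ^ k"
    by (simp add: exp_of_nat_mult)
  ultimately have "2 ^ k \<le> real n powr (26 / \<delta>\<^sup>2)"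
    using n by (simp add: powr_def)
  then show ?thesis using small \<open>k > 0\<close> by blast
qed

text \<open>The identity map works once distances are nonnegative; dimension 1 is the case required
  for n = 1.\<close>

lemma embeds_S1_refl:
  assumes "set As \<subseteq> carrier_mat 1 1" "D \<ge> 1"
  shows "embeds_S1 As 1 D"
  unfolding embeds_S1_def
proof (intro exI[of _ As] conjI allI impI)
  fix i j assume "i < length As" "j < length As"
  then have "As ! j \<in> carrier_mat 1 1" using assms by auto
  then have "schatten1_norm (As ! i - As ! j) \<ge> 0"
    by (intro schatten1_norm_dim_one_nonneg minus_carrier_mat)
  then show "schatten1_norm (As ! i - As ! j) \<le> D * schatten1_norm (As ! i - As ! j)"
    using assms(2) by (simp add: mult_le_cancel_right1)
qed (use assms in auto)

lemma embeds_S1_projections: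
  assumes n: "n \<ge> 2" and \<delta>: "0 < \<delta>" "\<delta> < 1" and m: "m > 0"
    and C: "\<And>i. i \<in> {1..n} \<Longrightarrow> C i \<in> carrier_mat m m \<and> hermitian_mat (C i) \<and> C i * C i = 1\<^sub>m m"
    and anti: "\<And>i j. i \<in> {1..n} \<Longrightarrow> j \<in> {1..n} \<Longrightarrow> i \<noteq> j \<Longrightarrow> C i * C j + C j * C i = 0\<^sub>m m m"
    and P: "\<And>i. i \<in> {1..n} \<Longrightarrow> is_orth_projection m (Pplus i) (eigenspace (C i) 1) \<and>
        is_orth_projection m (Pminus i) (eigenspace (C i) (- 1))"
    and k: "k > 0" "2 * real n * exp (- (k * (\<delta> / 2)\<^sup>2 / 2)) < 1"
  shows "embeds_S1
    ([0\<^sub>m m m, (1 / of_nat m) \<cdot>\<^sub>m 1\<^sub>m m]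
      @ map (\<lambda>i. (1 / of_nat m) \<cdot>\<^sub>m Pplus i) [1..<n+1]
      @ map (\<lambda>i. (1 / of_nat m) \<cdot>\<^sub>m Pminus i) [1..<n+1]) (2 ^ k) (1 + \<delta>)"
    (is "embeds_S1 ?As _ _")
proof -
  define T where "T = (\<lambda>k. complex_of_real (double_sign n k) \<cdot>\<^sub>m C (Suc (double_index n k)))"
  obtain x :: "nat \<Rightarrow> nat \<Rightarrow> real" where x: "\<And>i. i < n \<Longrightarrow> (\<Sum>l<k. x i l * x i l) = 1"
      "\<And>i j. i < n \<Longrightarrow> j < n \<Longrightarrow> i \<noteq> j \<Longrightarrow> \<bar>\<Sum>l<k. x i l * x j l\<bar> \<le> \<delta> / 2"
    using exists_nearly_orthogonal_unit_vectors[OF _ k(2,1)] \<delta> by auto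
  have x1: "\<bar>\<Sum>l<k. x i l * x j l\<bar> \<le> 1" if "i < n" "j < n" for i j
    using x(1)[of i] x(2)[of i j] that \<delta> by (cases "i = j") auto
  let ?g = "\<lambda>k l. double_sign n k * double_sign n l * (if double_index n k = double_index n l then 1 else 0)"
  let ?g' = "\<lambda>i j. double_sign n i * double_sign n j *
    (\<Sum>l<k. x (double_index n i) l * x (double_index n j) l)"
  have fam: "reflection_family m (2 * n) T ?g"
    unfolding T_def
    by (rule reflection_family_signed_double[OF reflection_family_anticommuting[OF n C anti]])
  have fam': "reflection_family (2 ^ k) (2 * n)
      (\<lambda>i. complex_of_real (double_sign n i) \<cdot>\<^sub>m clifford_sum k (x (double_index n i))) ?g'"
    by (rule reflection_family_signed_double[OF reflection_family_clifford_sum[OF x(1) x1]])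
  have "embeds_S1 (map (\<lambda>a. (1 / of_nat m) \<cdot>\<^sub>m reflection_point m T a) [0..<2 * n + 2]) (2 ^ k) (1 + \<delta>)"
  proof (rule embeds_S1_reflection_points[OF fam fam' m])
    fix a b assume "a < 2 * n + 2" "b < 2 * n + 2"
    then show "1 / sqrt (1 + \<delta> / 2) * reflection_dist ?g' a b \<le> reflection_dist ?g a b \<and>
        reflection_dist ?g a b \<le> (1 + \<delta>) * (1 / sqrt (1 + \<delta> / 2) * reflection_dist ?g' a b)"
      using x(2)
      by (intro reflection_dist_distortion[where h = "\<lambda>i j. \<Sum>l<k. x i l * x j l", OF \<delta> x(1)]) auto
  qed (use \<delta> in auto)
  moreover have "map (\<lambda>a. (1 / of_nat m) \<cdot>\<^sub>m reflection_point m T a) [0..<2 * n + 2] = ?As"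
  proof (rule nth_equalityI)
    fix a assume "a < length (map (\<lambda>a. (1 / of_nat m) \<cdot>\<^sub>m reflection_point m T a) [0..<2 * n + 2])"
    then have a: "a < 2 * n + 2" by simp
    \<comment> \<open>Positions 2 to n + 1 hold the projections for +1 and n + 2 to 2n + 1 those for
      -1, matching the doubled family; the given matrices are numbered from 1, hence
      \<open>Suc i\<close> below.\<close>
    consider "a = 0" | "a = 1" | i where "i < n" "a = i + 2" | i where "i < n" "a = i + n + 2"
    proof -
      assume *: "a = 0 \<Longrightarrow> thesis" "a = 1 \<Longrightarrow> thesis" "\<And>i. i < n \<Longrightarrow> a = i + 2 \<Longrightarrow> thesis"
        "\<And>i. i < n \<Longrightarrow> a = i + n + 2 \<Longrightarrow> thesis"
      show thesis using a *(1,2) *(3)[of "a - 2"] *(4)[of "a - n - 2"] by linarith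
    qed
    then have "(1 / of_nat m) \<cdot>\<^sub>m reflection_point m T a = ?As ! a"
    proof cases
      case 1
      then show ?thesis by (simp add: reflection_point_def)
    next
      case 2
      then show ?thesis by (simp add: reflection_point_def)
    next
      case 3
      then have i: "Suc i \<in> {1..n}" by simp
      have "complex_of_real 1 \<cdot>\<^sub>m C (Suc i) = C (Suc i)" by (rule eq_matI) auto
      then have "reflection_point m T a = Pplus (Suc i)"
        using orth_projection_eigenspace_one[of "C (Suc i)" m "Pplus (Suc i)"] C[OF i] P[OF i] 3
        by (simp add: reflection_point_def T_def double_sign_def double_index_def)
      moreover have "?As ! a = (1 / of_nat m) \<cdot>\<^sub>m Pplus (Suc i)"
        using 3 by (simp add: nth_append del: upt_Suc)
      ultimately show ?thesis by simp
    next
      case 4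
      then have i: "Suc i \<in> {1..n}" by simp
      have "complex_of_real (- 1) \<cdot>\<^sub>m C (Suc i) = - C (Suc i)" by (rule eq_matI) auto
      then have "reflection_point m T a = Pminus (Suc i)"
        using orth_projection_eigenspace_minus_one[of "C (Suc i)" m "Pminus (Suc i)"] C[OF i] P[OF i] 4
        by (simp add: reflection_point_def T_def double_sign_def double_index_def)
      moreover have "?As ! a = (1 / of_nat m) \<cdot>\<^sub>m Pminus (Suc i)"
        using 4 by (simp add: nth_append del: upt_Suc)
      ultimately show ?thesis by simp
    qed
    then show "map (\<lambda>a. (1 / of_nat m) \<cdot>\<^sub>m reflection_point m T a) [0..<2 * n + 2] ! a = ?As ! a"
      using a by (simp del: upt_Suc)
  qed simp
  ultimately show ?thesis by simp
qed

theorem lemma19: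
  shows "\<exists>K::real. K > 0 \<and>
    (\<forall>(n::nat) (\<delta>::real) (m::nat) (C :: nat \<Rightarrow> complex mat)
       (Pplus :: nat \<Rightarrow> complex mat) (Pminus :: nat \<Rightarrow> complex mat).
       n \<ge> 1 \<longrightarrow> 0 < \<delta> \<longrightarrow> \<delta> < 1 \<longrightarrow> m = 2 ^ (n div 2) \<longrightarrow>
       (\<forall>i \<in> {1..n}. C i \<in> carrier_mat m m \<and> hermitian_mat (C i) \<and> C i * C i = 1\<^sub>m m) \<longrightarrow>
       (\<forall>i \<in> {1..n}. \<forall>j \<in> {1..n}. i \<noteq> j \<longrightarrow> C i * C j + C j * C i = 0\<^sub>m m m) \<longrightarrow>
       (\<forall>i \<in> {1..n}. is_orth_projection m (Pplus i) (eigenspace (C i) 1) \<and>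
                     is_orth_projection m (Pminus i) (eigenspace (C i) (- 1))) \<longrightarrow>
       (\<exists>d::nat. d \<ge> 1 \<and> real d \<le> real n powr (K / \<delta>\<^sup>2) \<and>
          embeds_S1
            ([0\<^sub>m m m, (1 / of_nat m) \<cdot>\<^sub>m 1\<^sub>m m]
              @ map (\<lambda>i. (1 / of_nat m) \<cdot>\<^sub>m Pplus i) [1..<n+1]
              @ map (\<lambda>i. (1 / of_nat m) \<cdot>\<^sub>m Pminus i) [1..<n+1])
            d (1 + \<delta>)))"
proof (rule exI[of _ 26], intro conjI allI impI)
  fix n :: nat and \<delta> :: real and m :: nat and C Pplus Pminus :: "nat \<Rightarrow> complex mat"
  assume n: "n \<ge> 1" and \<delta>: "0 < \<delta>" "\<delta> < 1" and m: "m = 2 ^ (n div 2)"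
    and C: "\<forall>i \<in> {1..n}. C i \<in> carrier_mat m m \<and> hermitian_mat (C i) \<and> C i * C i = 1\<^sub>m m"
    and anti: "\<forall>i \<in> {1..n}. \<forall>j \<in> {1..n}. i \<noteq> j \<longrightarrow> C i * C j + C j * C i = 0\<^sub>m m m"
    and P: "\<forall>i \<in> {1..n}. is_orth_projection m (Pplus i) (eigenspace (C i) 1) \<and>
                     is_orth_projection m (Pminus i) (eigenspace (C i) (- 1))"
  let ?As = "[0\<^sub>m m m, (1 / of_nat m) \<cdot>\<^sub>m 1\<^sub>m m]
              @ map (\<lambda>i. (1 / of_nat m) \<cdot>\<^sub>m Pplus i) [1..<n+1]
              @ map (\<lambda>i. (1 / of_nat m) \<cdot>\<^sub>m Pminus i) [1..<n+1]"
  show "\<exists>d::nat. d \<ge> 1 \<and> real d \<le> real n powr (26 / \<delta>\<^sup>2) \<and> embeds_S1 ?As d (1 + \<delta>)"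
  proof (cases "n = 1")
    \<comment> \<open>Here the dimension bound is a power of 1, which forces d = 1; but m = 2^0 = 1
      already.\<close>
    case True
    then have "m = 1" using m by simp
    then have "set ?As \<subseteq> carrier_mat 1 1"
      using P True unfolding is_orth_projection_def by auto
    then have "embeds_S1 ?As 1 (1 + \<delta>)"
      using \<delta> by (intro embeds_S1_refl) auto
    then show ?thesis using True by (intro exI[of _ 1]) simp
  next
    case False
    then have n2: "n \<ge> 2" using n by simp
    obtain k where k: "k > 0" "2 * real n * exp (- (real k * (\<delta> / 2)\<^sup>2 / 2)) < 1"
        "2 ^ k \<le> real n powr (26 / \<delta>\<^sup>2)"
      using exists_clifford_dimension[OF n2 \<delta>] by blast
    have "embeds_S1 ?As (2 ^ k) (1 + \<delta>)"
      proof (rule embeds_S1_projections[where C = C, OF n2 \<delta> _ _ _ _ k(1,2)])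
      show "m > 0" using m by simp
    qed (use C anti P in blast)+
    then show ?thesis using k(3) by (intro exI[of _ "2 ^ k"]) simp
  qed
qed simp

end
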